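(* Any TAF-ring is a finite direct product of rings each of which is either a one-dimensional domain or a zero-dimensional local ring having nilpotent maximal ideal. In particular, a TAF-ring of dimension one having a unique height-zero prime ideal is a domain.
   Context: All rings are commutative with identity; dimension means Krull dimension; "local" means having a unique maximal ideal (not necessarily Noetherian). An ideal $I$ of a ring $R$ is a 2-absorbing ideal (TA-ideal) if whenever $a,b,c\in R$ and $abc\in I$, then $ab\in I$ or $ac\in I$ or $bc\in I$. A TA-factorization of an ideal $I$ is an expression $I=J_1\cdots J_n$ as a product of proper TA-ideals. $R$ is a TAF-ring if every proper ideal of $R$ has a TA-factorization. *)

theory Defs
  imports "HOL-Algebra.Chinese_Remainder" "HOL-Library.Extended_Real"
begin

definition prime_chain :: "('a, 'b) ring_scheme \<Rightarrow> nat \<Rightarrow> (nat \<Rightarrow> 'a set) \<Rightarrow> bool" where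
  "prime_chain R n P \<longleftrightarrow> (\<forall>i\<le>n. primeideal (P i) R) \<and> (\<forall>i<n. P i \<subset> P (Suc i))"

text \<open>Valued in \<^typ>\<open>ereal\<close>, so that infinite dimension is allowed and the zero ring,
  which has no prime ideals, gets dimension \<open>-\<infinity>\<close> rather than 0.\<close>

definition krull_dim :: "('a, 'b) ring_scheme \<Rightarrow> ereal" where
  "krull_dim R = (SUP n\<in>{n. \<exists>P. prime_chain R n P}. ereal (real n))"

definition prime_height :: "('a, 'b) ring_scheme \<Rightarrow> 'a set \<Rightarrow> ereal" where
  "prime_height R Q = (SUP n\<in>{n. \<exists>P. prime_chain R n P \<and> P n = Q}. ereal (real n))"

definition local_ring :: "('a, 'b) ring_scheme \<Rightarrow> bool" where
  "local_ring R \<longleftrightarrow> cring R \<and> (\<exists>!M. maximalideal M R)"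

definition nilpotent_ideal :: "('a, 'b) ring_scheme \<Rightarrow> 'a set \<Rightarrow> bool" where
  "nilpotent_ideal R I \<longleftrightarrow> ideal I R \<and> (\<exists>n::nat. I [^]\<^bsub>ideals_set R\<^esub> n = {\<zero>\<^bsub>R\<^esub>})"

definition TA_ideal :: "('a, 'b) ring_scheme \<Rightarrow> 'a set \<Rightarrow> bool" where
  "TA_ideal R I \<longleftrightarrow> ideal I R \<and>
     (\<forall>a\<in>carrier R. \<forall>b\<in>carrier R. \<forall>c\<in>carrier R.
        a \<otimes>\<^bsub>R\<^esub> b \<otimes>\<^bsub>R\<^esub> c \<in> I \<longrightarrow>
        a \<otimes>\<^bsub>R\<^esub> b \<in> I \<or> a \<otimes>\<^bsub>R\<^esub> c \<in> I \<or> b \<otimes>\<^bsub>R\<^esub> c \<in> I)"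

definition TA_factorization :: "('a, 'b) ring_scheme \<Rightarrow> 'a set \<Rightarrow> 'a set list \<Rightarrow> bool" where
  "TA_factorization R I Js \<longleftrightarrow> Js \<noteq> [] \<and>
     (\<forall>J\<in>set Js. TA_ideal R J \<and> J \<noteq> carrier R) \<and>
     I = foldr (ideal_prod R) Js (carrier R)"

definition TAF_ring :: "('a, 'b) ring_scheme \<Rightarrow> bool" where
  "TAF_ring R \<longleftrightarrow> cring R \<and>
     (\<forall>I. ideal I R \<and> I \<noteq> carrier R \<longrightarrow> (\<exists>Js. TA_factorization R I Js))"

end

(*
  The radical of a 2-absorbing ideal J is an intersection of at most two primes, and M^2 lies in
  J locally at every minimal prime M of J. So in a TAF-ring every ideal has finitely many minimal
  primes and contains, locally at each of them, a power of that prime. The key point is that a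
  prime P strictly below a prime M vanishes in the localization at M whenever M is minimal over
  (x, y) for some x in P. This forces the dimension to be at most one, and it makes every
  nonmaximal prime vanish in the localizations at the primes above it. Hence distinct minimal
  primes are comaximal, and the zero ideal is the intersection of the nonmaximal minimal primes
  and of powers of the maximal minimal primes; the Chinese remainder theorem gives the product
  decomposition. If there is only one minimal prime and it is not maximal, then it is zero.
*)

theory Submission
  imports Defs
begin

text \<open>No chain condition is available: primes need not be finitely generated, so neither
  Nakayama's lemma nor the Krull intersection theorem can turn a local equality P = MP into P = 0.
  Two features of TAF-rings stand in for them. M is also minimal over (x^2, y^2), so this ideal
  contains a power of M locally, and P, lying in all powers of M, falls into an ideal with two
  generators. Moreover each u in P generates an ideal with a 2-absorbing factor inside P, so the
  final cancellation is made on the principal ideal (u) and not on P.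

  For the same reason Krull's height theorem cannot bound the dimension. The vanishing result is
  stated for a pair (x, y) because it serves twice: with x outside all minimal primes it excludes
  chains of three primes, and, once the dimension is at most one, with x = 0 it treats every prime
  strictly below another. In both cases the elements come from prime avoidance, which applies
  because the minimal primes are finite in number.\<close>

no_notation Sum_Type.Plus (infixr \<open><+>\<close> 65)

text \<open>For a prime \<open>M\<close> this is the contraction to \<open>R\<close> of the extension of \<open>J\<close> to the localization
  at \<open>M\<close>; it replaces localizations throughout.\<close>

definition saturation :: "('a, 'b) ring_scheme \<Rightarrow> 'a set \<Rightarrow> 'a set \<Rightarrow> 'a set" where
  "saturation R M J = {r \<in> carrier R. \<exists>s\<in>carrier R - M. s \<otimes>\<^bsub>R\<^esub> r \<in> J}"

definition minimal_prime_over :: "('a, 'b) ring_scheme \<Rightarrow> 'a set \<Rightarrow> 'a set \<Rightarrow> bool" where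
  "minimal_prime_over R I P \<longleftrightarrow> primeideal P R \<and> I \<subseteq> P \<and>
     (\<forall>Q. primeideal Q R \<and> I \<subseteq> Q \<and> Q \<subseteq> P \<longrightarrow> Q = P)"

context cring
begin

section \<open>Elements of ideals and of prime ideals\<close>

lemma idealI_elements:
  assumes "I \<subseteq> carrier R" and "\<zero> \<in> I"
    and "\<And>a b. a \<in> I \<Longrightarrow> b \<in> I \<Longrightarrow> a \<oplus> b \<in> I"
    and l: "\<And>a r. a \<in> I \<Longrightarrow> r \<in> carrier R \<Longrightarrow> r \<otimes> a \<in> I"
  shows "ideal I R"
proof (rule idealI)
  show "ring R" by (rule ring_axioms)
  have neg: "\<ominus> a \<in> I" if "a \<in> I" for a
  proof -
    have "\<ominus> a = (\<ominus> \<one>) \<otimes> a" using that assms(1) l_minus[of \<one> a] by auto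
    then show ?thesis using l[OF that, of "\<ominus> \<one>"] by simp
  qed
  show "subgroup I (add_monoid R)"
    using assms neg by (auto intro!: add.subgroupI)
  show "x \<otimes> a \<in> I" if "a \<in> I" "x \<in> carrier R" for a x using that l by blast
  show "a \<otimes> x \<in> I" if "a \<in> I" "x \<in> carrier R" for a x
    using that l[of a x] assms(1) m_comm[of a x] by auto
qed

lemma ideal_carr: "ideal I R \<Longrightarrow> a \<in> I \<Longrightarrow> a \<in> carrier R"
  by (rule ideal.Icarr)

lemma ideal_add: "ideal I R \<Longrightarrow> a \<in> I \<Longrightarrow> b \<in> I \<Longrightarrow> a \<oplus> b \<in> I"
  by (simp add: additive_subgroup.a_closed ideal.axioms(1))

lemma ideal_zero: "ideal I R \<Longrightarrow> \<zero> \<in> I"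
  by (simp add: additive_subgroup.zero_closed ideal.axioms(1))

lemma ideal_neg: "ideal I R \<Longrightarrow> a \<in> I \<Longrightarrow> \<ominus> a \<in> I"
  by (simp add: additive_subgroup.a_inv_closed ideal.axioms(1))

lemma ideal_diff: "ideal I R \<Longrightarrow> a \<in> I \<Longrightarrow> b \<in> I \<Longrightarrow> a \<ominus> b \<in> I"
  by (simp add: a_minus_def ideal_add ideal_neg)

lemma ideal_l: "ideal I R \<Longrightarrow> a \<in> I \<Longrightarrow> r \<in> carrier R \<Longrightarrow> r \<otimes> a \<in> I"
  by (rule ideal.I_l_closed)

lemma ideal_r: "ideal I R \<Longrightarrow> a \<in> I \<Longrightarrow> r \<in> carrier R \<Longrightarrow> a \<otimes> r \<in> I"
  by (rule ideal.I_r_closed)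

lemma ideal_add_cancel:
  assumes "ideal I R" "a \<oplus> b \<in> I" "a \<in> I" "b \<in> carrier R"
  shows "b \<in> I"
proof -
  have "a \<in> carrier R" using assms ideal_carr by blast
  then have "b = (a \<oplus> b) \<ominus> a" using assms(4) by algebra
  then show ?thesis using ideal_diff[OF assms(1-3)] by simp
qed

lemma ideal_add_cancel':
  assumes "ideal I R" "a \<oplus> b \<in> I" "b \<in> I" "a \<in> carrier R"
  shows "a \<in> I"
  using assms ideal_add_cancel[of I b a] a_comm ideal_carr by metis

lemmas ideal_intros = ideal_add ideal_zero ideal_neg ideal_diff ideal_l ideal_r

lemma prime_ideal: "primeideal P R \<Longrightarrow> ideal P R"
  by (rule primeideal.axioms(1))

lemma prime_mult_iff:
  "primeideal P R \<Longrightarrow> a \<in> carrier R \<Longrightarrow> b \<in> carrier R \<Longrightarrow> a \<otimes> b \<in> P \<longleftrightarrow> a \<in> P \<or> b \<in> P"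
  by (meson primeideal.I_prime prime_ideal ideal_l ideal_r)

lemma proper_iff_one: "ideal I R \<Longrightarrow> I \<noteq> carrier R \<longleftrightarrow> \<one> \<notin> I"
  using ideal.one_imp_carrier by blast

lemma prime_one: "primeideal P R \<Longrightarrow> \<one> \<notin> P"
  using primeideal.I_notcarr proper_iff_one prime_ideal by blast

lemma prod_memI: "a \<in> I \<Longrightarrow> b \<in> J \<Longrightarrow> a \<otimes> b \<in> I \<cdot> J"
  by (rule ideal_prod.prod)

lemma prod_subsetI:
  assumes "ideal K R" "\<And>a b. a \<in> I \<Longrightarrow> b \<in> J \<Longrightarrow> a \<otimes> b \<in> K"
  shows "I \<cdot> J \<subseteq> K"
proof
  fix x assume "x \<in> I \<cdot> J"
  then show "x \<in> K" by induct (auto intro: assms ideal_add)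
qed

lemma prime_prod_subset:
  assumes P: "primeideal P R" and I: "ideal I R" "ideal J R" and s: "I \<cdot> J \<subseteq> P"
  shows "I \<subseteq> P \<or> J \<subseteq> P"
proof (rule ccontr)
  assume "\<not> ?thesis"
  then obtain a b where ab: "a \<in> I" "a \<notin> P" "b \<in> J" "b \<notin> P" by blast
  then have "a \<otimes> b \<in> P" using s prod_memI by blast
  then show False using ab prime_mult_iff[OF P] ideal_carr I by blast
qed

lemma prime_inter_subset:
  assumes P: "primeideal P R" and I: "ideal I R" "ideal J R" and s: "I \<inter> J \<subseteq> P"
  shows "I \<subseteq> P \<or> J \<subseteq> P"
  using prime_prod_subset[OF P I] ideal_prod_inter[OF I] s by blast

section \<open>Saturations\<close>

lemma satI:
  "s \<in> carrier R \<Longrightarrow> s \<notin> M \<Longrightarrow> r \<in> carrier R \<Longrightarrow> s \<otimes> r \<in> J \<Longrightarrow> r \<in> saturation R M J"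
  unfolding saturation_def by blast

lemma satE:
  assumes "r \<in> saturation R M J"
  obtains s where "r \<in> carrier R" "s \<in> carrier R" "s \<notin> M" "s \<otimes> r \<in> J"
  using assms unfolding saturation_def by blast

lemma sat_ideal:
  assumes M: "primeideal M R" and J: "ideal J R"
  shows "ideal (saturation R M J) R"
proof (rule idealI_elements)
  show "saturation R M J \<subseteq> carrier R" unfolding saturation_def by blast
  show "\<zero> \<in> saturation R M J"
    by (rule satI[of \<one>]) (use prime_one[OF M] ideal_zero[OF J] in auto)
next
  fix a b assume "a \<in> saturation R M J" "b \<in> saturation R M J"
  then obtain s t where s: "a \<in> carrier R" "s \<in> carrier R" "s \<notin> M" "s \<otimes> a \<in> J"
    and t: "b \<in> carrier R" "t \<in> carrier R" "t \<notin> M" "t \<otimes> b \<in> J" by (blast elim: satE)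
  have "t \<otimes> (s \<otimes> a) \<oplus> s \<otimes> (t \<otimes> b) \<in> J" using s t J by (blast intro: ideal_intros)
  moreover have "t \<otimes> (s \<otimes> a) \<oplus> s \<otimes> (t \<otimes> b) = (s \<otimes> t) \<otimes> (a \<oplus> b)"
    using s t by algebra
  moreover have "s \<otimes> t \<notin> M" using s t prime_mult_iff[OF M] by blast
  ultimately show "a \<oplus> b \<in> saturation R M J"
    using s t satI[of "s \<otimes> t"] by auto
next
  fix a r assume "a \<in> saturation R M J" and r: "r \<in> carrier R"
  then obtain s where s: "a \<in> carrier R" "s \<in> carrier R" "s \<notin> M" "s \<otimes> a \<in> J" by (blast elim: satE)
  have "r \<otimes> (s \<otimes> a) \<in> J" using s r J by (blast intro: ideal_intros)
  moreover have "r \<otimes> (s \<otimes> a) = s \<otimes> (r \<otimes> a)" using s r by algebra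
  ultimately show "r \<otimes> a \<in> saturation R M J" using s r satI[of s] by auto
qed

lemma sat_mono: "J \<subseteq> K \<Longrightarrow> saturation R M J \<subseteq> saturation R M K"
  unfolding saturation_def by blast

lemma sat_superset:
  assumes M: "primeideal M R" and J: "ideal J R"
  shows "J \<subseteq> saturation R M J"
proof
  fix a assume "a \<in> J"
  then show "a \<in> saturation R M J"
    using satI[of \<one> M a J] prime_one[OF M] ideal_carr[OF J] by auto
qed

lemma sat_trans:
  assumes M: "primeideal M R" and B: "A \<subseteq> saturation R M B" "B \<subseteq> saturation R M C"
  shows "A \<subseteq> saturation R M C"
proof
  fix a assume "a \<in> A"
  then obtain s where s: "a \<in> carrier R" "s \<in> carrier R" "s \<notin> M" "s \<otimes> a \<in> B"
    using B by (blast elim: satE)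
  then obtain t where t: "t \<in> carrier R" "t \<notin> M" "t \<otimes> (s \<otimes> a) \<in> C" using B by (blast elim: satE)
  then have "(t \<otimes> s) \<otimes> a \<in> C" using s by (simp add: m_assoc)
  then show "a \<in> saturation R M C" using s t satI[of "t \<otimes> s"] prime_mult_iff[OF M] by blast
qed

lemma sat_prod:
  assumes M: "primeideal M R" and I: "ideal A' R" "ideal B' R"
    and A: "A \<subseteq> saturation R M A'" and B: "B \<subseteq> saturation R M B'"
  shows "A \<cdot> B \<subseteq> saturation R M (A' \<cdot> B')"
proof (rule prod_subsetI)
  show "ideal (saturation R M (A' \<cdot> B')) R" using sat_ideal[OF M ideal_prod_is_ideal[OF I]] .
  fix a b assume "a \<in> A" "b \<in> B"
  then obtain s t where s: "a \<in> carrier R" "s \<in> carrier R" "s \<notin> M" "s \<otimes> a \<in> A'"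
    and t: "b \<in> carrier R" "t \<in> carrier R" "t \<notin> M" "t \<otimes> b \<in> B'" using A B by (blast elim: satE)
  have "(s \<otimes> a) \<otimes> (t \<otimes> b) \<in> A' \<cdot> B'" by (rule prod_memI[OF s(4) t(4)])
  moreover have "(s \<otimes> a) \<otimes> (t \<otimes> b) = (s \<otimes> t) \<otimes> (a \<otimes> b)" using s t by algebra
  moreover have "s \<otimes> t \<notin> M" using s t prime_mult_iff[OF M] by blast
  ultimately show "a \<otimes> b \<in> saturation R M (A' \<cdot> B')"
    using s t satI[of "s \<otimes> t"] by auto
qed

text \<open>A multiplier outside M is outside every prime P inside M, so primality of P removes it.
  With J = 0: whatever vanishes locally at M lies in all primes inside M.\<close>

lemma sat_subset_prime:
  assumes M: "primeideal M R" and P: "primeideal P R" "P \<subseteq> M" "J \<subseteq> P"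
  shows "saturation R M J \<subseteq> P"
  using assms prime_mult_iff[OF P(1)] unfolding saturation_def by blast

section \<open>2-absorbing ideals\<close>

lemma TA_ideal_ideal: "TA_ideal R J \<Longrightarrow> ideal J R"
  unfolding TA_ideal_def by blast

lemma TA_idealD:
  "TA_ideal R J \<Longrightarrow> a \<in> carrier R \<Longrightarrow> b \<in> carrier R \<Longrightarrow> c \<in> carrier R \<Longrightarrow> a \<otimes> b \<otimes> c \<in> J
    \<Longrightarrow> a \<otimes> b \<in> J \<or> a \<otimes> c \<in> J \<or> b \<otimes> c \<in> J"
  unfolding TA_ideal_def by blast

text \<open>The product a(a + b)b lies in J because both squares do, and each of its three pairs
  yields ab. This makes \<open>square_radical J\<close> closed under addition and also puts every
  product of two of its elements into J.\<close>

lemma TA_square_mult: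
  assumes J: "TA_ideal R J" and a: "a \<in> carrier R" "a \<otimes> a \<in> J" and b: "b \<in> carrier R" "b \<otimes> b \<in> J"
  shows "a \<otimes> b \<in> J"
proof -
  note I = TA_ideal_ideal[OF J]
  have "(a \<otimes> a) \<otimes> b \<oplus> a \<otimes> (b \<otimes> b) \<in> J" using a b I by (blast intro: ideal_intros)
  moreover have "(a \<otimes> a) \<otimes> b \<oplus> a \<otimes> (b \<otimes> b) = a \<otimes> (a \<oplus> b) \<otimes> b" using a b by algebra
  ultimately consider "a \<otimes> (a \<oplus> b) \<in> J" | "a \<otimes> b \<in> J" | "(a \<oplus> b) \<otimes> b \<in> J"
    using TA_idealD[OF J, of a "a \<oplus> b" b] a b by auto
  then show ?thesis
  proof cases
    case 1
    then have "a \<otimes> a \<oplus> a \<otimes> b \<in> J" using a b r_distr by simp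
    then show ?thesis using ideal_add_cancel[OF I] a b by simp
  next
    case 3
    then have "a \<otimes> b \<oplus> b \<otimes> b \<in> J" using a b l_distr by simp
    then show ?thesis using ideal_add_cancel'[OF I] a b by simp
  qed
qed

text \<open>For a 2-absorbing ideal this is the full radical, by \<open>square_radical_radical\<close> below.\<close>

definition square_radical :: "'a set \<Rightarrow> 'a set" where
  "square_radical J = {r \<in> carrier R. r \<otimes> r \<in> J}"

lemma square_radical_ideal:
  assumes J: "TA_ideal R J"
  shows "ideal (square_radical J) R"
proof (rule idealI_elements)
  note I = TA_ideal_ideal[OF J]
  show "square_radical J \<subseteq> carrier R" "\<zero> \<in> square_radical J"
    unfolding square_radical_def using ideal_zero[OF I] by auto
  show "a \<oplus> b \<in> square_radical J" if "a \<in> square_radical J" "b \<in> square_radical J" for a b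
  proof -
    have ab: "a \<in> carrier R" "a \<otimes> a \<in> J" "b \<in> carrier R" "b \<otimes> b \<in> J"
      using that unfolding square_radical_def by auto
    have "(a \<otimes> a \<oplus> b \<otimes> b) \<oplus> (a \<otimes> b \<oplus> a \<otimes> b) \<in> J"
      using ab I TA_square_mult[OF J ab] by (blast intro: ideal_intros)
    moreover have "(a \<otimes> a \<oplus> b \<otimes> b) \<oplus> (a \<otimes> b \<oplus> a \<otimes> b) = (a \<oplus> b) \<otimes> (a \<oplus> b)"
      using ab by algebra
    ultimately show ?thesis unfolding square_radical_def using ab by simp
  qed
  show "r \<otimes> a \<in> square_radical J" if "a \<in> square_radical J" "r \<in> carrier R" for a r
  proof -
    have a: "a \<in> carrier R" "a \<otimes> a \<in> J" using that unfolding square_radical_def by auto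
    have "(r \<otimes> r) \<otimes> (a \<otimes> a) \<in> J" using a that I by (blast intro: ideal_intros)
    moreover have "(r \<otimes> r) \<otimes> (a \<otimes> a) = (r \<otimes> a) \<otimes> (r \<otimes> a)" using a that by algebra
    ultimately show ?thesis unfolding square_radical_def using a that by simp
  qed
qed

text \<open>From r^4 in J the absorbing property descends to r^3 and then to r^2, so a second square
  root adds nothing.\<close>

lemma square_radical_radical:
  assumes J: "TA_ideal R J" and r: "r \<in> carrier R" "r \<otimes> r \<in> square_radical J"
  shows "r \<in> square_radical J"
proof -
  have "r \<otimes> r \<otimes> (r \<otimes> r) \<in> J" using r unfolding square_radical_def by simp
  then consider "r \<otimes> r \<in> J" | "r \<otimes> (r \<otimes> r) \<in> J"
    using TA_idealD[OF J, of r r "r \<otimes> r"] r by auto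
  then have "r \<otimes> r \<in> J"
  proof cases
    case 2
    then have "r \<otimes> r \<otimes> r \<in> J" using r m_assoc by simp
    then show ?thesis using TA_idealD[OF J, of r r r] r by auto
  qed
  then show ?thesis unfolding square_radical_def using r by simp
qed

lemma square_radical_TA:
  assumes J: "TA_ideal R J"
  shows "TA_ideal R (square_radical J)"
  unfolding TA_ideal_def
proof (intro conjI ballI impI)
  show "ideal (square_radical J) R" by (rule square_radical_ideal[OF J])
  fix a b c assume abc: "a \<in> carrier R" "b \<in> carrier R" "c \<in> carrier R" "a \<otimes> b \<otimes> c \<in> square_radical J"
  then have "(a \<otimes> b \<otimes> c) \<otimes> (a \<otimes> b \<otimes> c) \<in> J" unfolding square_radical_def by simp
  moreover have "(a \<otimes> b \<otimes> c) \<otimes> (a \<otimes> b \<otimes> c) = (a \<otimes> a) \<otimes> (b \<otimes> b) \<otimes> (c \<otimes> c)" using abc by algebra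
  ultimately have "(a \<otimes> a) \<otimes> (b \<otimes> b) \<in> J \<or> (a \<otimes> a) \<otimes> (c \<otimes> c) \<in> J \<or> (b \<otimes> b) \<otimes> (c \<otimes> c) \<in> J"
    using TA_idealD[OF J, of "a \<otimes> a" "b \<otimes> b" "c \<otimes> c"] abc by simp
  moreover have sq: "(x \<otimes> x) \<otimes> (y \<otimes> y) = (x \<otimes> y) \<otimes> (x \<otimes> y)"
    if "x \<in> carrier R" "y \<in> carrier R" for x y using that by algebra
  ultimately show "a \<otimes> b \<in> square_radical J \<or> a \<otimes> c \<in> square_radical J \<or> b \<otimes> c \<in> square_radical J"
    unfolding square_radical_def using abc sq[OF abc(1,2)] sq[OF abc(1,3)] sq[OF abc(2,3)] by simp
qed

text \<open>Suppose rsa is in N but ra and sa are not; then rs is in N. Adding b to r or s changes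
  neither assumption, because ab is in N. Comparing the results for r and for r + b leaves b^2 in N,
  hence b in N.\<close>

lemma radical_TA_colon_prime:
  assumes N: "TA_ideal R N" and rad: "\<And>r. r \<in> carrier R \<Longrightarrow> r \<otimes> r \<in> N \<Longrightarrow> r \<in> N"
    and a: "a \<in> carrier R" "a \<notin> N" and b: "b \<in> carrier R" "b \<notin> N" and ab: "a \<otimes> b \<in> N"
  shows "primeideal {r \<in> carrier R. r \<otimes> a \<in> N} R"
proof (rule primeidealI)
  note I = TA_ideal_ideal[OF N]
  show "ideal {r \<in> carrier R. r \<otimes> a \<in> N} R"
    by (rule idealI_elements) (use a I in \<open>auto simp: l_distr m_assoc intro: ideal_intros\<close>)
  show "cring R" by (rule is_cring)
  show "carrier R \<noteq> {r \<in> carrier R. r \<otimes> a \<in> N}"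
    using a one_closed l_one by (metis (mono_tags, lifting) mem_Collect_eq)
  fix r s assume r: "r \<in> carrier R" and s: "s \<in> carrier R"
    and "r \<otimes> s \<in> {r \<in> carrier R. r \<otimes> a \<in> N}"
  then have rsa: "r \<otimes> s \<otimes> a \<in> N" by simp
  have "r \<otimes> a \<in> N \<or> s \<otimes> a \<in> N"
  proof (rule ccontr)
    assume "\<not> ?thesis"
    then have ra: "r \<otimes> a \<notin> N" and sa: "s \<otimes> a \<notin> N" by auto
    have rs: "r \<otimes> s \<in> N" using TA_idealD[OF N r s a(1) rsa] ra sa by blast
    have shift: "(t \<oplus> b) \<otimes> a \<notin> N" if "t \<in> carrier R" "t \<otimes> a \<notin> N" for t
    proof
      assume "(t \<oplus> b) \<otimes> a \<in> N"
      then have "t \<otimes> a \<oplus> a \<otimes> b \<in> N" using that a b by (simp add: l_distr m_comm[of a b])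
      then show False using ideal_add_cancel'[OF I _ ab] that a by auto
    qed
    \<comment> \<open>The hypotheses are symmetric in t and u and survive replacing t by t + b, so
      the same fact is used for (r, s), (s, r) and (s, r + b).\<close>
    have key: "b \<otimes> u \<in> N" if tu: "t \<in> carrier R" "u \<in> carrier R" "t \<otimes> u \<in> N" "t \<otimes> a \<notin> N" "u \<otimes> a \<notin> N" for t u
    proof -
      have "(t \<otimes> u) \<otimes> a \<oplus> (a \<otimes> b) \<otimes> u \<in> N" using tu a b ab I by (blast intro: ideal_intros)
      moreover have "(t \<otimes> u) \<otimes> a \<oplus> (a \<otimes> b) \<otimes> u = (t \<oplus> b) \<otimes> u \<otimes> a" using tu a b by algebra
      ultimately have "(t \<oplus> b) \<otimes> u \<in> N"
        using TA_idealD[OF N, of "t \<oplus> b" u a] tu a b shift[of t] by auto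
      then have "t \<otimes> u \<oplus> b \<otimes> u \<in> N" using tu b by (simp add: l_distr)
      then show ?thesis using ideal_add_cancel[OF I] tu b by auto
    qed
    have bs: "b \<otimes> s \<in> N" using key[of r s] r s rs ra sa by blast
    have "(r \<oplus> b) \<otimes> s \<in> N" using rs bs r s b I ideal_add by (simp add: l_distr)
    then have "s \<otimes> (r \<oplus> b) \<in> N" using r s b by (simp add: m_comm)
    then have "b \<otimes> (r \<oplus> b) \<in> N" using key[of s "r \<oplus> b"] r s b sa shift[OF r ra] by auto
    moreover have "b \<otimes> r \<in> N" using key[of s r] r s rs ra sa m_comm by auto
    ultimately have "b \<otimes> b \<in> N" using ideal_add_cancel[OF I, of "b \<otimes> r" "b \<otimes> b"] r b r_distr by auto
    then show False using rad b by blast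
  qed
  then show "r \<in> {r \<in> carrier R. r \<otimes> a \<in> N} \<or> s \<in> {r \<in> carrier R. r \<otimes> a \<in> N}"
    using r s by simp
qed

text \<open>For \<^term>\<open>P = Q\<close> this covers the case of a prime radical.\<close>

lemma TA_radical_two_primes:
  assumes J: "TA_ideal R J" and proper: "J \<noteq> carrier R"
  obtains P Q where "primeideal P R" "primeideal Q R" "square_radical J = P \<inter> Q"
proof -
  define N where "N = square_radical J"
  have N: "TA_ideal R N" using square_radical_TA[OF J] N_def by simp
  note I = TA_ideal_ideal[OF N]
  have rad: "r \<in> N" if "r \<in> carrier R" "r \<otimes> r \<in> N" for r
    using square_radical_radical[OF J that(1)] that(2) unfolding N_def by blast
  have "\<one> \<notin> J" using proper proper_iff_one TA_ideal_ideal[OF J] by blast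
  then have "\<one> \<notin> N" unfolding N_def square_radical_def by simp
  then have Nproper: "carrier R \<noteq> N" using one_closed by blast
  show thesis
  proof (cases "primeideal N R")
    case True
    show thesis by (rule that[OF True True]) (simp add: N_def)
  next
    case False
    then obtain a b where a: "a \<in> carrier R" "a \<notin> N" and b: "b \<in> carrier R" "b \<notin> N"
      and ab: "a \<otimes> b \<in> N"
      using ideal.primeidealCD[OF I is_cring False] Nproper by blast
    define P where "P = {r \<in> carrier R. r \<otimes> a \<in> N}"
    define Q where "Q = {r \<in> carrier R. r \<otimes> b \<in> N}"
    have P: "primeideal P R" unfolding P_def by (rule radical_TA_colon_prime[OF N rad a b ab])
    have Q: "primeideal Q R" unfolding Q_def
      by (rule radical_TA_colon_prime[OF N rad b a]) (use a b ab m_comm in auto)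
    have "P \<inter> Q \<subseteq> N"
    proof
      fix r assume "r \<in> P \<inter> Q"
      then have r: "r \<in> carrier R" "r \<otimes> a \<in> N" "r \<otimes> b \<in> N" unfolding P_def Q_def by auto
      show "r \<in> N"
      proof (rule ccontr)
        assume rN: "r \<notin> N"
        \<comment> \<open>The elements a, b, r have pairwise products in N, hence (a + b)(b + r)(r +
          a) is in N. By the absorbing property one of the three partial products is in N; modulo N
          it is the square of the element shared by its two factors, and N would contain that
          element.\<close>
        have cancel: "y \<in> N"
          if xyz: "x \<in> carrier R" "y \<in> carrier R" "z \<in> carrier R" "x \<otimes> y \<in> N" "x \<otimes> z \<in> N" "y \<otimes> z \<in> N"
            "(x \<oplus> y) \<otimes> (y \<oplus> z) \<in> N" for x y z
        proof -
          have "(x \<oplus> y) \<otimes> (y \<oplus> z) = (x \<otimes> y \<oplus> x \<otimes> z \<oplus> y \<otimes> z) \<oplus> y \<otimes> y" using xyz by algebra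
          moreover have "x \<otimes> y \<oplus> x \<otimes> z \<oplus> y \<otimes> z \<in> N" using xyz I ideal_add by simp
          ultimately have "y \<otimes> y \<in> N" using ideal_add_cancel[OF I] xyz by auto
          then show ?thesis by (rule rad[OF xyz(2)])
        qed
        have ba: "b \<otimes> a \<in> N" "a \<otimes> r \<in> N" "b \<otimes> r \<in> N" using ab r a b m_comm by auto
        have "(a \<otimes> b) \<otimes> (a \<oplus> b \<oplus> r \<oplus> r) \<oplus> (r \<otimes> a) \<otimes> (a \<oplus> r) \<oplus> (r \<otimes> b) \<otimes> (b \<oplus> r) \<in> N"
          using a b r ab I by (blast intro: ideal_intros a_closed)
        moreover have "(a \<otimes> b) \<otimes> (a \<oplus> b \<oplus> r \<oplus> r) \<oplus> (r \<otimes> a) \<otimes> (a \<oplus> r) \<oplus> (r \<otimes> b) \<otimes> (b \<oplus> r)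
          = (a \<oplus> b) \<otimes> (b \<oplus> r) \<otimes> (r \<oplus> a)" using a b r by algebra
        ultimately consider "(a \<oplus> b) \<otimes> (b \<oplus> r) \<in> N" | "(a \<oplus> b) \<otimes> (r \<oplus> a) \<in> N" | "(b \<oplus> r) \<otimes> (r \<oplus> a) \<in> N"
          using TA_idealD[OF N, of "a \<oplus> b" "b \<oplus> r" "r \<oplus> a"] a b r by auto
        then show False
        proof cases
          case 1
          then show False using cancel[of a b r] a b r ab ba by blast
        next
          case 2
          then have "(b \<oplus> a) \<otimes> (a \<oplus> r) \<in> N" using a b r a_comm by simp
          then show False using cancel[of b a r] a b r ab ba by blast
        next
          case 3
          then show False using cancel[of b r a] a b r ab ba rN by blast
        qed
      qed
    qed
    moreover have "N \<subseteq> P \<inter> Q" unfolding P_def Q_def using I a b ideal_carr ideal_r by auto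
    ultimately show thesis using that[OF P Q] N_def by blast
  qed
qed

lemma square_radical_superset: "ideal J R \<Longrightarrow> J \<subseteq> square_radical J"
  unfolding square_radical_def using ideal_carr ideal_l by blast

lemma prime_contains_square_radical:
  "primeideal P R \<Longrightarrow> J \<subseteq> P \<Longrightarrow> square_radical J \<subseteq> P"
  unfolding square_radical_def using prime_mult_iff by blast

text \<open>F may contain primes that are not minimal over J. In this form the property passes to a
  product of ideals by taking the union of the sets F, whereas a union of sets of minimal primes may
  contain primes that are not minimal over the product.\<close>

lemma TA_primes_above:
  assumes J: "TA_ideal R J" and proper: "J \<noteq> carrier R"
  obtains F where "finite F" "F \<noteq> {}" "\<forall>P\<in>F. primeideal P R \<and> J \<subseteq> P"
    "\<forall>T. primeideal T R \<longrightarrow> J \<subseteq> T \<longrightarrow> (\<exists>P\<in>F. P \<subseteq> T)"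
proof -
  obtain P Q where PQ: "primeideal P R" "primeideal Q R" "square_radical J = P \<inter> Q"
    by (rule TA_radical_two_primes[OF J proper])
  have sup: "J \<subseteq> P \<inter> Q" using square_radical_superset[OF TA_ideal_ideal[OF J]] PQ by blast
  show thesis
  proof (rule that[of "{P, Q}"])
    show "\<forall>T. primeideal T R \<longrightarrow> J \<subseteq> T \<longrightarrow> (\<exists>P\<in>{P, Q}. P \<subseteq> T)"
    proof (intro allI impI)
      fix T assume T: "primeideal T R" "J \<subseteq> T"
      then have "P \<inter> Q \<subseteq> T" using prime_contains_square_radical PQ by blast
      then show "\<exists>P\<in>{P, Q}. P \<subseteq> T"
        using prime_inter_subset[OF T(1) prime_ideal[OF PQ(1)] prime_ideal[OF PQ(2)]] by blast
    qed
  qed (use PQ sup in auto)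
qed

text \<open>Minimality makes M one of the two primes whose intersection is the radical. If the other
  one is not inside M, an element s of it outside M multiplies M into the radical; otherwise M is
  the radical and s = 1 works. By \<open>TA_square_mult\<close> the multiplier s^2 then carries
  products of two elements of M into J.\<close>

lemma TA_minimal_prime_square:
  assumes J: "TA_ideal R J" and M: "minimal_prime_over R J M"
  shows "M \<cdot> M \<subseteq> saturation R M J"
proof (rule prod_subsetI)
  have Mp: "primeideal M R" "J \<subseteq> M" using M unfolding minimal_prime_over_def by auto
  have "J \<noteq> carrier R" using Mp prime_one one_closed by blast
  then obtain P Q where PQ: "primeideal P R" "primeideal Q R" "square_radical J = P \<inter> Q"
    by (rule TA_radical_two_primes[OF J])
  note I = TA_ideal_ideal[OF J]
  show "ideal (saturation R M J) R" by (rule sat_ideal[OF Mp(1) I])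
  have sup: "J \<subseteq> P \<inter> Q" using square_radical_superset[OF I] PQ by blast
  have sub: "P \<inter> Q \<subseteq> M" using prime_contains_square_radical Mp PQ by blast
  have eq: "P \<subseteq> M \<Longrightarrow> P = M" "Q \<subseteq> M \<Longrightarrow> Q = M"
    using M PQ sup unfolding minimal_prime_over_def by auto
  have "P \<subseteq> M \<or> Q \<subseteq> M" using prime_inter_subset[OF Mp(1) prime_ideal[OF PQ(1)] prime_ideal[OF PQ(2)] sub] by blast
  then have "M = P \<inter> Q \<or> (\<exists>s\<in>carrier R. s \<notin> M \<and> (\<forall>m\<in>M. s \<otimes> m \<in> P \<inter> Q))"
  proof (rule disjE)
    assume "P \<subseteq> M"
    then have "P = M" using eq by blast
    show ?thesis
    proof (cases "Q \<subseteq> M")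
      case False
      then obtain s where s: "s \<in> Q" "s \<notin> M" by blast
      then have "s \<otimes> m \<in> P \<inter> Q" if "m \<in> M" for m
        using that \<open>P = M\<close> PQ prime_ideal ideal_carr ideal_l ideal_r by (metis Int_iff)
      then show ?thesis using s PQ prime_ideal ideal_carr by blast
    qed (use eq \<open>P = M\<close> in auto)
  next
    assume "Q \<subseteq> M"
    then have "Q = M" using eq by blast
    show ?thesis
    proof (cases "P \<subseteq> M")
      case False
      then obtain s where s: "s \<in> P" "s \<notin> M" by blast
      then have "s \<otimes> m \<in> P \<inter> Q" if "m \<in> M" for m
        using that \<open>Q = M\<close> PQ prime_ideal ideal_carr ideal_l ideal_r by (metis Int_iff)
      then show ?thesis using s PQ prime_ideal ideal_carr by blast
    qed (use eq \<open>Q = M\<close> in auto)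
  qed
  then obtain s where s: "s \<in> carrier R" "s \<notin> M" and sm: "\<And>m. m \<in> M \<Longrightarrow> s \<otimes> m \<in> square_radical J"
  proof (elim disjE bexE conjE)
    assume "M = P \<inter> Q"
    then show thesis
      using that[of \<one>] PQ prime_one[OF Mp(1)] ideal_carr[OF prime_ideal[OF Mp(1)]] by auto
  qed (use that PQ in auto)
  fix a b assume ab: "a \<in> M" "b \<in> M"
  then have c: "a \<in> carrier R" "b \<in> carrier R" using ideal_carr prime_ideal Mp by auto
  have "(s \<otimes> a) \<otimes> (s \<otimes> b) \<in> J"
    using TA_square_mult[OF J] sm[OF ab(1)] sm[OF ab(2)] unfolding square_radical_def by auto
  moreover have "(s \<otimes> a) \<otimes> (s \<otimes> b) = (s \<otimes> s) \<otimes> (a \<otimes> b)" using s c by algebra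
  moreover have "s \<otimes> s \<notin> M" using s prime_mult_iff[OF Mp(1)] by blast
  ultimately show "a \<otimes> b \<in> saturation R M J" using satI[of "s \<otimes> s"] s c by auto
qed

section \<open>TA-factorizations\<close>

abbreviation ideal_list_prod :: "'a set list \<Rightarrow> 'a set" where
  "ideal_list_prod Js \<equiv> foldr (ideal_prod R) Js (carrier R)"

lemma ideal_list_prod_ideal: "\<forall>J\<in>set Js. ideal J R \<Longrightarrow> ideal (ideal_list_prod Js) R"
  by (induct Js) (auto intro: oneideal ideal_prod_is_ideal)

lemma ideal_list_prod_subset:
  "\<forall>J\<in>set Js. ideal J R \<Longrightarrow> J \<in> set Js \<Longrightarrow> ideal_list_prod Js \<subseteq> J"
proof (induct Js)
  case (Cons K Js)
  have "K \<cdot> ideal_list_prod Js \<subseteq> K \<inter> ideal_list_prod Js"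
    using Cons(2) ideal_list_prod_ideal by (intro ideal_prod_inter) auto
  then show ?case using Cons by auto
qed simp

lemma prime_ideal_list_prod_subset:
  assumes T: "primeideal T R"
  shows "\<forall>J\<in>set Js. ideal J R \<Longrightarrow> ideal_list_prod Js \<subseteq> T \<Longrightarrow> \<exists>J\<in>set Js. J \<subseteq> T"
proof (induct Js)
  case Nil
  then show ?case using prime_one[OF T] one_closed by auto
next
  case (Cons K Js)
  then have "ideal (ideal_list_prod Js) R" using ideal_list_prod_ideal by simp
  then have "K \<subseteq> T \<or> ideal_list_prod Js \<subseteq> T"
    using prime_prod_subset[OF T, of K "ideal_list_prod Js"] Cons by simp
  then show ?case using Cons by auto
qed

lemma ideal_list_prod_remove:
  assumes "\<forall>J\<in>set (xs @ K # ys). ideal J R"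
  shows "ideal_list_prod (xs @ K # ys) = K \<cdot> ideal_list_prod (xs @ ys)"
  using assms
proof (induct xs)
  case (Cons J xs)
  have i: "ideal J R" "ideal K R" "ideal (ideal_list_prod (xs @ ys)) R"
    using Cons(2) ideal_list_prod_ideal[of "xs @ ys"] by auto
  have "ideal_list_prod ((J # xs) @ K # ys) = J \<cdot> (K \<cdot> ideal_list_prod (xs @ ys))"
    using Cons by simp
  also have "\<dots> = K \<cdot> (J \<cdot> ideal_list_prod (xs @ ys))"
    using i ideal_prod_assoc ideal_prod_commute by metis
  finally show ?case by simp
qed simp

section \<open>Primes above an ideal of a TAF-ring\<close>

lemma TAF_obtain:
  assumes "TAF_ring R" "ideal I R" "I \<noteq> carrier R"
  obtains Js where "\<forall>J\<in>set Js. TA_ideal R J" "\<forall>J\<in>set Js. J \<noteq> carrier R"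
    "\<forall>J\<in>set Js. ideal J R" "I = ideal_list_prod Js"
proof -
  obtain Js where "TA_factorization R I Js" using assms unfolding TAF_ring_def by blast
  then show thesis using that[of Js] TA_ideal_ideal unfolding TA_factorization_def by blast
qed

text \<open>Of the factorization only one 2-absorbing factor inside T is kept. The others are lumped
  together in L, which is just an ideal and may be the whole ring.\<close>

lemma TAF_factor_in_prime:
  assumes "TAF_ring R" "ideal I R" and T: "primeideal T R" "I \<subseteq> T"
  obtains J L where "TA_ideal R J" "J \<subseteq> T" "ideal L R" "I = J \<cdot> L"
proof -
  have "I \<noteq> carrier R" using T prime_one one_closed by blast
  then obtain Js where Js: "\<forall>J\<in>set Js. TA_ideal R J"
    "\<forall>J\<in>set Js. J \<noteq> carrier R" "\<forall>J\<in>set Js. ideal J R" "I = ideal_list_prod Js"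
    by (rule TAF_obtain[OF assms(1,2)])
  obtain J where J: "J \<in> set Js" "J \<subseteq> T"
    using prime_ideal_list_prod_subset[OF T(1) Js(3)] T(2) unfolding Js(4) by blast
  then obtain xs ys where xy: "Js = xs @ J # ys" using split_list by fast
  show thesis
  proof (rule that[of J "ideal_list_prod (xs @ ys)"])
    show "ideal (ideal_list_prod (xs @ ys)) R" using Js(3) xy by (intro ideal_list_prod_ideal) auto
    show "I = J \<cdot> ideal_list_prod (xs @ ys)" using Js(3,4) xy ideal_list_prod_remove by simp
  qed (use J Js in auto)
qed

lemma TAF_primes_above:
  assumes "TAF_ring R" "ideal I R" "I \<noteq> carrier R"
  obtains F where "finite F" "F \<noteq> {}" "\<forall>P\<in>F. primeideal P R \<and> I \<subseteq> P"
    "\<forall>T. primeideal T R \<longrightarrow> I \<subseteq> T \<longrightarrow> (\<exists>P\<in>F. P \<subseteq> T)"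
proof -
  obtain Js where Js: "\<forall>J\<in>set Js. TA_ideal R J" "\<forall>J\<in>set Js. J \<noteq> carrier R"
    "\<forall>J\<in>set Js. ideal J R" "I = ideal_list_prod Js"
    by (rule TAF_obtain[OF assms])
  have "\<forall>J\<in>set Js. \<exists>F. finite F \<and> F \<noteq> {} \<and> (\<forall>P\<in>F. primeideal P R \<and> J \<subseteq> P) \<and>
      (\<forall>T. primeideal T R \<longrightarrow> J \<subseteq> T \<longrightarrow> (\<exists>P\<in>F. P \<subseteq> T))"
  proof
    fix J assume J: "J \<in> set Js"
    obtain F where "finite F" "F \<noteq> {}" "\<forall>P\<in>F. primeideal P R \<and> J \<subseteq> P"
      "\<forall>T. primeideal T R \<longrightarrow> J \<subseteq> T \<longrightarrow> (\<exists>P\<in>F. P \<subseteq> T)"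
      by (rule TA_primes_above[OF Js(1)[rule_format, OF J] Js(2)[rule_format, OF J]])
    then show "\<exists>F. finite F \<and> F \<noteq> {} \<and> (\<forall>P\<in>F. primeideal P R \<and> J \<subseteq> P) \<and>
      (\<forall>T. primeideal T R \<longrightarrow> J \<subseteq> T \<longrightarrow> (\<exists>P\<in>F. P \<subseteq> T))" by blast
  qed
  then obtain F where F: "\<forall>J\<in>set Js. finite (F J) \<and> F J \<noteq> {} \<and> (\<forall>P\<in>F J. primeideal P R \<and> J \<subseteq> P) \<and>
      (\<forall>T. primeideal T R \<longrightarrow> J \<subseteq> T \<longrightarrow> (\<exists>P\<in>F J. P \<subseteq> T))" by metis
  have "set Js \<noteq> {}" using assms(3) Js(4) by auto
  show thesis
  proof (rule that[of "\<Union>J\<in>set Js. F J"])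
    show "finite (\<Union>J\<in>set Js. F J)" "(\<Union>J\<in>set Js. F J) \<noteq> {}" using F \<open>set Js \<noteq> {}\<close> by auto
    show "\<forall>P\<in>(\<Union>J\<in>set Js. F J). primeideal P R \<and> I \<subseteq> P"
    proof
      fix P assume "P \<in> (\<Union>J\<in>set Js. F J)"
      then obtain J where J: "J \<in> set Js" "P \<in> F J" by auto
      have "primeideal P R \<and> J \<subseteq> P" using F[rule_format, OF J(1)] J(2) by simp
      then show "primeideal P R \<and> I \<subseteq> P"
        using ideal_list_prod_subset[OF Js(3) J(1)] Js(4) by auto
    qed
    show "\<forall>T. primeideal T R \<longrightarrow> I \<subseteq> T \<longrightarrow> (\<exists>P\<in>(\<Union>J\<in>set Js. F J). P \<subseteq> T)"
    proof (intro allI impI)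
      fix T assume T: "primeideal T R" "I \<subseteq> T"
      obtain J where J: "J \<in> set Js" "J \<subseteq> T"
        using prime_ideal_list_prod_subset[OF T(1) Js(3)] T(2) unfolding Js(4) by blast
      then have "\<exists>P\<in>F J. P \<subseteq> T" using F[rule_format, OF J(1)] T(1) by simp
      then show "\<exists>P\<in>(\<Union>J\<in>set Js. F J). P \<subseteq> T" using J(1) by auto
    qed
  qed
qed

text \<open>The finite set F has a minimal member M among those inside T. It is minimal over I among
  all primes, since any prime over I contains a member of F.\<close>

lemma TAF_minimal_prime_below:
  assumes TAF: "TAF_ring R" "ideal I R" and T: "primeideal T R" "I \<subseteq> T"
  obtains M where "minimal_prime_over R I M" "M \<subseteq> T"
proof -
  have "I \<noteq> carrier R" using T prime_one one_closed by blast
  then obtain F where F: "finite F" "F \<noteq> {}" "\<forall>P\<in>F. primeideal P R \<and> I \<subseteq> P"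
    "\<forall>T. primeideal T R \<longrightarrow> I \<subseteq> T \<longrightarrow> (\<exists>P\<in>F. P \<subseteq> T)"
    by (rule TAF_primes_above[OF TAF])
  have fin: "finite {P \<in> F. P \<subseteq> T}" "{P \<in> F. P \<subseteq> T} \<noteq> {}" using F(1) F(4)[rule_format, OF T] by auto
  obtain M where M: "M \<in> {P \<in> F. P \<subseteq> T}" "\<forall>P\<in>{P \<in> F. P \<subseteq> T}. P \<subseteq> M \<longrightarrow> M = P"
    by (rule bexE[OF finite_has_minimal[OF fin]])
  have "minimal_prime_over R I M"
    unfolding minimal_prime_over_def
  proof (intro conjI allI impI)
    fix Q assume Q: "primeideal Q R \<and> I \<subseteq> Q \<and> Q \<subseteq> M"
    then obtain P where P: "P \<in> F" "P \<subseteq> Q" using F(4) by blast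
    have "P \<subseteq> M" "P \<subseteq> T" using P Q M(1) by auto
    then have "M = P" using M(2) P(1) by simp
    then show "Q = M" using P Q by simp
  qed (use M F in auto)
  then show thesis using that M by blast
qed

lemma TAF_finite_minimal_primes:
  assumes TAF: "TAF_ring R" "ideal I R"
  shows "finite {P. minimal_prime_over R I P}"
proof (cases "I = carrier R")
  case True
  then have "{P. minimal_prime_over R I P} = {}"
    unfolding minimal_prime_over_def using prime_one one_closed by blast
  then show ?thesis by simp
next
  case False
  then obtain F where F: "finite F" "F \<noteq> {}" "\<forall>P\<in>F. primeideal P R \<and> I \<subseteq> P"
    "\<forall>T. primeideal T R \<longrightarrow> I \<subseteq> T \<longrightarrow> (\<exists>P\<in>F. P \<subseteq> T)"
    by (rule TAF_primes_above[OF TAF])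
  have "{P. minimal_prime_over R I P} \<subseteq> F"
  proof
    fix P assume "P \<in> {P. minimal_prime_over R I P}"
    then have P: "primeideal P R" "I \<subseteq> P" "\<And>Q. primeideal Q R \<Longrightarrow> I \<subseteq> Q \<Longrightarrow> Q \<subseteq> P \<Longrightarrow> Q = P"
      unfolding minimal_prime_over_def by auto
    then obtain Q where "Q \<in> F" "Q \<subseteq> P" using F(4) by blast
    then show "P \<in> F" using P(3) F(3) by blast
  qed
  then show ?thesis using F(1) finite_subset by blast
qed

lemma TAF_proper_in_prime:
  assumes TAF: "TAF_ring R" "ideal I R" "I \<noteq> carrier R"
  obtains P where "primeideal P R" "I \<subseteq> P"
proof -
  obtain F where F: "finite F" "F \<noteq> {}" "\<forall>P\<in>F. primeideal P R \<and> I \<subseteq> P"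
    "\<forall>T. primeideal T R \<longrightarrow> I \<subseteq> T \<longrightarrow> (\<exists>P\<in>F. P \<subseteq> T)"
    by (rule TAF_primes_above[OF TAF])
  then show thesis using that by blast
qed

section \<open>Powers of ideals\<close>

abbreviation ideal_power :: "'a set \<Rightarrow> nat \<Rightarrow> 'a set" where
  "ideal_power M n \<equiv> M [^]\<^bsub>ideals_set R\<^esub> n"

lemma ideals_set_one [simp]: "\<one>\<^bsub>ideals_set R\<^esub> = carrier R"
  unfolding ideals_set_def by simp

lemma ideals_set_mult [simp]: "I \<otimes>\<^bsub>ideals_set R\<^esub> J = I \<cdot> J"
  unfolding ideals_set_def by simp

lemma ideal_power_ideal: "ideal M R \<Longrightarrow> ideal (ideal_power M n) R"
  by (induct n) (auto simp: oneideal ideal_prod_is_ideal)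

lemma ideal_power_add:
  assumes "ideal M R"
  shows "ideal_power M (m + n) = ideal_power M m \<cdot> ideal_power M n"
proof (induct n)
  case 0
  then show ?case using assms ideal_prod_one ideal_power_ideal by simp
next
  case (Suc n)
  then show ?case using assms ideal_power_ideal by (simp add: ideal_prod_assoc)
qed

lemma ideal_power_subset:
  assumes "ideal M R" "0 < n"
  shows "ideal_power M n \<subseteq> M"
proof -
  obtain k where "n = Suc k" using assms(2) gr0_conv_Suc by blast
  then show ?thesis using ideal_prod_inter[OF ideal_power_ideal[OF assms(1), of k] assms(1)] by simp
qed

lemma prime_ideal_power_subset:
  assumes P: "primeideal P R" and M: "ideal M R"
  shows "ideal_power M n \<subseteq> P \<Longrightarrow> M \<subseteq> P"
proof (induct n)
  case 0
  then show ?case using prime_one[OF P] one_closed by auto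
next
  case (Suc n)
  then show ?case using prime_prod_subset[OF P ideal_power_ideal[OF M] M] by auto
qed

lemma minimal_prime_over_larger:
  "minimal_prime_over R I M \<Longrightarrow> I \<subseteq> J \<Longrightarrow> J \<subseteq> M \<Longrightarrow> minimal_prime_over R J M"
  unfolding minimal_prime_over_def by blast

text \<open>Exponents add up over the factors: a factor inside M contributes 2 by
  \<open>TA_minimal_prime_square\<close>, as M is minimal over it too; a factor not inside M is the
  whole ring locally and contributes 0.\<close>

lemma TAF_minimal_prime_power:
  assumes TAF: "TAF_ring R" "ideal I R" and M: "minimal_prime_over R I M"
  obtains n where "ideal_power M n \<subseteq> saturation R M I"
proof -
  have Mp: "primeideal M R" "I \<subseteq> M" using M unfolding minimal_prime_over_def by auto
  have Mi: "ideal M R" using prime_ideal Mp by blast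
  have "I \<noteq> carrier R" using Mp prime_one one_closed by blast
  then obtain Js where Js: "\<forall>J\<in>set Js. TA_ideal R J"
    "\<forall>J\<in>set Js. J \<noteq> carrier R" "\<forall>J\<in>set Js. ideal J R" "I = ideal_list_prod Js"
    by (rule TAF_obtain[OF TAF])
  have min: "minimal_prime_over R J M" if "J \<in> set Js" "J \<subseteq> M" for J
    using minimal_prime_over_larger[OF M _ that(2)] ideal_list_prod_subset[OF Js(3) that(1)] Js(4) by simp
  have "\<exists>n. ideal_power M n \<subseteq> saturation R M (ideal_list_prod Js)"
    using Js(1)[rule_format] min
  proof (induct Js)
    case Nil
    show ?case using sat_superset[OF Mp(1) oneideal] by (intro exI[of _ 0]) simp
  next
    case (Cons J Js)
    have J: "ideal J R" and Ks: "ideal (ideal_list_prod Js) R"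
      using Cons(2) TA_ideal_ideal ideal_list_prod_ideal by auto
    obtain n where n: "ideal_power M n \<subseteq> saturation R M (ideal_list_prod Js)" using Cons by auto
    have "\<exists>k. ideal_power M k \<subseteq> saturation R M J"
    proof (cases "J \<subseteq> M")
      case True
      then have "M \<cdot> M \<subseteq> saturation R M J" using TA_minimal_prime_square Cons(2,3) by simp
      moreover have "ideal_power M (Suc (Suc 0)) = M \<cdot> M"
        using ideal_prod_one[OF Mi] ideal_prod_commute[OF Mi oneideal]
        by simp
      ultimately show ?thesis by metis
    next
      case False
      then obtain s where s: "s \<in> J" "s \<notin> M" by blast
      have "carrier R \<subseteq> saturation R M J"
      proof
        fix r assume r: "r \<in> carrier R"
        show "r \<in> saturation R M J"
          by (rule satI[OF ideal_carr[OF J s(1)] s(2) r ideal_r[OF J s(1) r]])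
      qed
      then show ?thesis by (intro exI[of _ 0]) simp
    qed
    then obtain k where k: "ideal_power M k \<subseteq> saturation R M J" by blast
    have "ideal_power M (k + n) \<subseteq> saturation R M (ideal_list_prod (J # Js))"
      unfolding ideal_power_add[OF Mi] using sat_prod[OF Mp(1) J Ks k n] by simp
    then show ?case by (rule exI)
  qed
  then show thesis unfolding Js(4)[symmetric] using that by blast
qed

section \<open>Primes below a prime minimal over two elements\<close>

text \<open>In the localization at M this says that a unit minus an element of the maximal ideal is
  a unit. Cancellations of Nakayama type rest on it: from su = mu one passes to (s - m)u = 0 with an
  admissible multiplier.\<close>

lemma prime_minus_notin:
  assumes "primeideal M R" "s \<in> carrier R" "s \<notin> M" "m \<in> M"
  shows "s \<ominus> m \<notin> M"
proof
  note Mi = prime_ideal[OF assms(1)]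
  assume "s \<ominus> m \<in> M"
  then have "(s \<ominus> m) \<oplus> m \<in> M" by (rule ideal_add[OF Mi _ assms(4)])
  moreover have "(s \<ominus> m) \<oplus> m = s" using assms(2) ideal_carr[OF Mi assms(4)] by algebra
  ultimately show False using assms(3) by simp
qed

section \<open>Enlarging an ideal by one generator\<close>

lemma add_principal_memI: "p \<in> I \<Longrightarrow> r \<in> carrier R \<Longrightarrow> p \<oplus> r \<otimes> y \<in> I <+> PIdl y"
  unfolding set_add_def' cgenideal_def by blast

lemma add_principal_memE:
  assumes "z \<in> I <+> PIdl y"
  obtains p r where "p \<in> I" "r \<in> carrier R" "z = p \<oplus> r \<otimes> y"
  using assms unfolding set_add_def' cgenideal_def by blast

lemma add_principal_self:
  assumes "ideal I R" "y \<in> carrier R"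
  shows "y \<in> I <+> PIdl y" "I \<subseteq> I <+> PIdl y"
proof -
  show "y \<in> I <+> PIdl y"
    using add_principal_memI[OF ideal_zero[OF assms(1)] one_closed, of y] assms(2) by simp
  show "I \<subseteq> I <+> PIdl y"
  proof
    fix p assume p: "p \<in> I"
    then show "p \<in> I <+> PIdl y"
      using add_principal_memI[OF p zero_closed, of y] assms ideal_carr[OF assms(1) p] by simp
  qed
qed

lemma add_principal_ideal: "ideal I R \<Longrightarrow> y \<in> carrier R \<Longrightarrow> ideal (I <+> PIdl y) R"
  by (rule add_ideals[OF _ cgenideal_ideal])

lemma add_principal_subset:
  assumes "ideal J R" "I \<subseteq> J" "y \<in> J"
  shows "I <+> PIdl y \<subseteq> J"
proof
  fix z assume "z \<in> I <+> PIdl y"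
  then obtain p r where "p \<in> I" "r \<in> carrier R" "z = p \<oplus> r \<otimes> y" by (rule add_principal_memE)
  then show "z \<in> J" using assms(2) ideal_add[OF assms(1) _ ideal_l[OF assms(1,3)]] by auto
qed

lemma cgenidealI: "r \<in> carrier R \<Longrightarrow> r \<otimes> y \<in> PIdl y"
  unfolding cgenideal_def by blast

lemma cgenidealE:
  assumes "z \<in> PIdl y"
  obtains r where "r \<in> carrier R" "z = r \<otimes> y"
  using assms unfolding cgenideal_def by blast

text \<open>Modulo P both cd = ry and c'd = r'y hold, so d(rc' - r'c) is in P and d cancels. When r
  is outside M, this says that modulo P and locally at M the element c generates every c' with c'd
  in P + (y).\<close>

lemma factors_generate_mod_prime:
  assumes P: "primeideal P R" and p: "p \<in> P" and y: "y \<in> carrier R"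
    and cd: "c \<in> carrier R" "d \<in> carrier R" "d \<notin> P" "r \<in> carrier R" "c \<otimes> d = p \<oplus> r \<otimes> y"
    and c': "c' \<in> carrier R" "c' \<otimes> d \<in> P <+> PIdl y"
  obtains r' p' where "r' \<in> carrier R" "p' \<in> P" "r \<otimes> c' = r' \<otimes> c \<oplus> p'"
proof -
  note Pi = prime_ideal[OF P]
  note pc = ideal_carr[OF Pi]
  obtain q r' where q: "q \<in> P" "r' \<in> carrier R" "c' \<otimes> d = q \<oplus> r' \<otimes> y"
    using c'(2) by (rule add_principal_memE)
  define p' where "p' = r \<otimes> c' \<ominus> r' \<otimes> c"
  have p'c: "p' \<in> carrier R" unfolding p'_def using cd c' q by simp
  have "d \<otimes> p' = r \<otimes> (c' \<otimes> d) \<ominus> r' \<otimes> (c \<otimes> d)"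
    unfolding p'_def using cd(1,2,4) c'(1) q(2) by algebra
  also have "\<dots> = r \<otimes> q \<ominus> r' \<otimes> p"
    unfolding q(3) cd(5) using cd(4) q(2) pc[OF q(1)] pc[OF p] y by algebra
  also have "\<dots> \<in> P"
    by (intro ideal_diff[OF Pi] ideal_l[OF Pi] q(1,2) p cd(4))
  finally have "p' \<in> P" using prime_mult_iff[OF P cd(2) p'c] cd(3) by simp
  moreover have "r \<otimes> c' = r' \<otimes> c \<oplus> p'"
    unfolding p'_def using cd(1,4) c'(1) q(2) by algebra
  ultimately show thesis using that[OF q(2)] by blast
qed

text \<open>In the localization at \<open>M\<close>, the ideal \<open>P + (y\<^sup>3)\<close> is not 2-absorbing, since otherwise it would
  contain \<open>y\<^sup>2\<close>. So it is a product of two ideals inside \<open>M\<close>, which modulo \<open>P\<close> are generated by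
  factors \<open>a\<close> and \<open>b\<close> of \<open>y\<^sup>3\<close> up to a unit; comparing products gives \<open>P \<subseteq> (ab) + MP\<close>,
  and \<open>ab\<close> is a nonzerodivisor modulo \<open>P\<close>.\<close>

lemma TAF_prime_subset_sat_mult:
  assumes TAF: "TAF_ring R" and P: "primeideal P R" and M: "primeideal M R" and PM: "P \<subseteq> M"
    and xP: "x \<in> P" and yM: "y \<in> M" "y \<notin> P"
    and min: "\<And>Q. primeideal Q R \<Longrightarrow> x \<in> Q \<Longrightarrow> y \<in> Q \<Longrightarrow> Q \<subseteq> M \<Longrightarrow> Q = M"
  shows "P \<subseteq> saturation R M (M \<cdot> P)"
proof -
  note Pi = prime_ideal[OF P] and Mi = prime_ideal[OF M]
  note pc = ideal_carr[OF Pi] and mc = ideal_carr[OF Mi]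
  have yc: "y \<in> carrier R" using mc yM by blast
  define z where "z = y \<otimes> (y \<otimes> y)"
  have zc: "z \<in> carrier R" unfolding z_def using yc by simp
  have zM: "z \<in> M" unfolding z_def using ideal_r[OF Mi yM(1)] yc by simp
  have zprime: "z \<in> Q \<Longrightarrow> y \<in> Q" if "primeideal Q R" for Q
    unfolding z_def using prime_mult_iff[OF that] yc by auto
  define L where "L = P <+> PIdl z"
  have Li: "ideal L R" unfolding L_def by (rule add_principal_ideal[OF Pi zc])
  have LM: "L \<subseteq> M" unfolding L_def by (rule add_principal_subset[OF Mi PM zM])
  have PL: "P \<subseteq> L" and zL: "z \<in> L" unfolding L_def using add_principal_self[OF Pi zc] by auto
  have minL: "minimal_prime_over R L M"
    unfolding minimal_prime_over_def
  proof (intro conjI allI impI)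
    fix Q assume Q: "primeideal Q R \<and> L \<subseteq> Q \<and> Q \<subseteq> M"
    then have "x \<in> Q" "z \<in> Q" using PL xP zL by auto
    then show "Q = M" using min[of Q] zprime[of Q] Q by simp
  qed (use M LM in auto)
  obtain A B where A: "TA_ideal R A" "A \<subseteq> M" and Bi: "ideal B R" and LAB: "L = A \<cdot> B"
    by (rule TAF_factor_in_prime[OF TAF Li M LM])
  note Ai = TA_ideal_ideal[OF A(1)]
  note ac = ideal_carr[OF Ai] and bc = ideal_carr[OF Bi]
  have LA: "L \<subseteq> A" and LB: "L \<subseteq> B" using ideal_prod_inter[OF Ai Bi] LAB by auto
  \<comment> \<open>If B were not inside M, then A would lie in L locally, and L would contain y^2
    locally, because M is minimal over the 2-absorbing ideal A. From ty^2 = p + ry^3 follows (t -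
    ry)y^2 in P, although neither y nor t - ry is in P.\<close>
  have BM: "B \<subseteq> M"
  proof (rule ccontr)
    assume "\<not> B \<subseteq> M"
    then obtain s where s: "s \<in> B" "s \<notin> M" by blast
    have AL: "A \<subseteq> saturation R M L"
    proof
      fix a assume a: "a \<in> A"
      have "s \<otimes> a = a \<otimes> s" using ac[OF a] bc[OF s(1)] by (rule m_comm[symmetric])
      then have "s \<otimes> a \<in> L" unfolding LAB using prod_memI[OF a s(1)] by simp
      then show "a \<in> saturation R M L" using satI[OF bc[OF s(1)] s(2) ac[OF a]] by simp
    qed
    have "M \<cdot> M \<subseteq> saturation R M A"
      by (rule TA_minimal_prime_square[OF A(1) minimal_prime_over_larger[OF minL LA A(2)]])
    then have "M \<cdot> M \<subseteq> saturation R M L" using sat_trans[OF M _ AL] by blast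
    then have "y \<otimes> y \<in> saturation R M L" using prod_memI[OF yM(1) yM(1)] by blast
    then obtain t where t: "t \<in> carrier R" "t \<notin> M" "t \<otimes> (y \<otimes> y) \<in> L" by (rule satE)
    obtain p r where p: "p \<in> P" "r \<in> carrier R" "t \<otimes> (y \<otimes> y) = p \<oplus> r \<otimes> z"
      using t(3) unfolding L_def by (rule add_principal_memE)
    have "(t \<ominus> r \<otimes> y) \<otimes> (y \<otimes> y) = t \<otimes> (y \<otimes> y) \<ominus> r \<otimes> z"
      unfolding z_def using t(1) p(2) yc by algebra
    also have "\<dots> = p" unfolding p(3) using pc[OF p(1)] p(2) zc by algebra
    finally have "(t \<ominus> r \<otimes> y) \<otimes> (y \<otimes> y) \<in> P" using p(1) by simp
    then have "t \<ominus> r \<otimes> y \<in> P" using prime_mult_iff[OF P] yM(2) yc t(1) p(2) by auto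
    then have "t \<ominus> r \<otimes> y \<in> M" using PM by blast
    then show False
      using prime_minus_notin[OF M t(1,2) ideal_l[OF Mi yM(1) p(2)]] by blast
  qed
  \<comment> \<open>Local generators: some product ab equals z modulo P up to a multiplier r outside
    M. Otherwise all products lie in W = P + Mz, so z itself does, and (1 - m)z is in P for some m
    in M.\<close>
  have "\<exists>a\<in>A. \<exists>b\<in>B. \<exists>p\<in>P. \<exists>r\<in>carrier R - M. a \<otimes> b = p \<oplus> r \<otimes> z"
  proof (rule ccontr)
    assume neg: "\<not> ?thesis"
    define W where "W = {w \<in> carrier R. \<exists>p\<in>P. \<exists>m\<in>M. w = p \<oplus> m \<otimes> z}"
    have Wi: "ideal W R"
    proof (rule idealI_elements)
      show "W \<subseteq> carrier R" unfolding W_def by blast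
      have "\<zero> = \<zero> \<oplus> \<zero> \<otimes> z" using zc by simp
      then show "\<zero> \<in> W" unfolding W_def using ideal_zero[OF Pi] ideal_zero[OF Mi] by blast
    next
      fix u v assume "u \<in> W" "v \<in> W"
      then obtain p m p' m' where u: "p \<in> P" "m \<in> M" "u = p \<oplus> m \<otimes> z" "p' \<in> P" "m' \<in> M" "v = p' \<oplus> m' \<otimes> z"
        unfolding W_def by blast
      note c = pc[OF u(1)] mc[OF u(2)] pc[OF u(4)] mc[OF u(5)] zc
      have "u \<oplus> v = (p \<oplus> p') \<oplus> (m \<oplus> m') \<otimes> z" unfolding u(3,6) using c by algebra
      moreover have "u \<oplus> v \<in> carrier R" unfolding u(3,6) using c by simp
      ultimately show "u \<oplus> v \<in> W"
        unfolding W_def using ideal_add[OF Pi u(1,4)] ideal_add[OF Mi u(2,5)] by blast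
    next
      fix u r assume "u \<in> W" and r: "r \<in> carrier R"
      then obtain p m where u: "p \<in> P" "m \<in> M" "u = p \<oplus> m \<otimes> z" unfolding W_def by blast
      note c = pc[OF u(1)] mc[OF u(2)] zc r
      have "r \<otimes> u = r \<otimes> p \<oplus> (r \<otimes> m) \<otimes> z" unfolding u(3) using c by algebra
      moreover have "r \<otimes> u \<in> carrier R" unfolding u(3) using c by simp
      ultimately show "r \<otimes> u \<in> W"
        unfolding W_def using ideal_l[OF Pi u(1) r] ideal_l[OF Mi u(2) r] by blast
    qed
    have "A \<cdot> B \<subseteq> W"
    proof (rule prod_subsetI[OF Wi])
      fix a b assume ab: "a \<in> A" "b \<in> B"
      then have "a \<otimes> b \<in> P <+> PIdl z" using prod_memI[OF ab] LAB L_def by simp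
      then obtain p r where p: "p \<in> P" "r \<in> carrier R" "a \<otimes> b = p \<oplus> r \<otimes> z"
        by (rule add_principal_memE)
      then have "r \<in> M" using neg ab by blast
      then show "a \<otimes> b \<in> W" unfolding W_def using p ac[OF ab(1)] bc[OF ab(2)] by blast
    qed
    then have "z \<in> W" using zL LAB by blast
    then obtain p m where p: "p \<in> P" "m \<in> M" "z = p \<oplus> m \<otimes> z" unfolding W_def by blast
    note c = pc[OF p(1)] mc[OF p(2)] zc
    have "(\<one> \<ominus> m) \<otimes> z = z \<ominus> m \<otimes> z" using c by algebra
    also have "\<dots> = (p \<oplus> m \<otimes> z) \<ominus> m \<otimes> z" using p(3) by simp
    also have "\<dots> = p" using c by algebra
    finally have "(\<one> \<ominus> m) \<otimes> z \<in> P" using p(1) by simp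
    moreover have "z \<notin> P" using zprime[OF P] yM(2) by blast
    ultimately have "\<one> \<ominus> m \<in> P" using prime_mult_iff[OF P _ zc] c(2) by simp
    then show False using prime_minus_notin[OF M one_closed prime_one[OF M] p(2)] PM by blast
  qed
  then obtain a b p r where a: "a \<in> A" and b: "b \<in> B" and p: "p \<in> P"
    and r: "r \<in> carrier R" "r \<notin> M" and ab: "a \<otimes> b = p \<oplus> r \<otimes> z" by blast
  note c = ac[OF a] bc[OF b] pc[OF p]
  have abP: "a \<otimes> b \<notin> P"
  proof
    assume "a \<otimes> b \<in> P"
    then have "r \<otimes> z \<in> P" using ideal_add_cancel[OF Pi _ p] r(1) zc unfolding ab by simp
    then show False using prime_mult_iff[OF P r(1) zc] zprime[OF P] yM(2) PM r(2) by blast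
  qed
  then have aP: "a \<notin> P" and bP: "b \<notin> P" using prime_mult_iff[OF P c(1,2)] by auto
  define K where "K = (M \<cdot> P) <+> PIdl (a \<otimes> b)"
  have MPi: "ideal (M \<cdot> P) R" by (rule ideal_prod_is_ideal[OF Mi Pi])
  have Ki: "ideal K R" unfolding K_def using add_principal_ideal[OF MPi] c by simp
  \<comment> \<open>Up to multipliers outside M, a' and b' are multiples of a and b plus elements pa
    and pb of P. In the expanded product every term except the multiple of ab has a factor in P and
    another in M, because a, b and pa lie in M.\<close>
  have "A \<cdot> B \<subseteq> saturation R M K"
  proof (rule prod_subsetI[OF sat_ideal[OF M Ki]])
    fix a' b' assume a': "a' \<in> A" and b': "b' \<in> B"
    note c' = ac[OF a'] bc[OF b']
    have "a' \<otimes> b \<in> P <+> PIdl z" using prod_memI[OF a' b] LAB L_def by simp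
    then obtain ra pa where ra: "ra \<in> carrier R" "pa \<in> P" "r \<otimes> a' = ra \<otimes> a \<oplus> pa"
      by (rule factors_generate_mod_prime[OF P p zc c(1,2) bP r(1) ab c'(1)])
    have ba: "b \<otimes> a = p \<oplus> r \<otimes> z" using ab m_comm[OF c(1,2)] by simp
    have "b' \<otimes> a \<in> P <+> PIdl z" using prod_memI[OF a b'] LAB L_def c c' m_comm by simp
    then obtain rb pb where rb: "rb \<in> carrier R" "pb \<in> P" "r \<otimes> b' = rb \<otimes> b \<oplus> pb"
      by (rule factors_generate_mod_prime[OF P p zc c(2,1) aP r(1) ba c'(2)])
    note cc = c ra(1) rb(1) pc[OF ra(2)] pc[OF rb(2)] r(1) c'
    have "(r \<otimes> r) \<otimes> (a' \<otimes> b') = (r \<otimes> a') \<otimes> (r \<otimes> b')" using cc by algebra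
    also have "\<dots> = ((a \<otimes> (ra \<otimes> pb) \<oplus> b \<otimes> (rb \<otimes> pa)) \<oplus> pa \<otimes> pb) \<oplus> (ra \<otimes> rb) \<otimes> (a \<otimes> b)"
      unfolding ra(3) rb(3) using cc by algebra
    also have "\<dots> \<in> K"
      unfolding K_def
    proof (rule add_principal_memI)
      have "a \<in> M" "b \<in> M" "pa \<in> M" using a b A(2) BM ra(2) PM by auto
      then show "(a \<otimes> (ra \<otimes> pb) \<oplus> b \<otimes> (rb \<otimes> pa)) \<oplus> pa \<otimes> pb \<in> M \<cdot> P"
        by (intro ideal_add[OF MPi] prod_memI ideal_l[OF Pi] ra(1,2) rb(1,2))
    qed (use cc in simp)
    finally have "(r \<otimes> r) \<otimes> (a' \<otimes> b') \<in> K" .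
    moreover have "r \<otimes> r \<notin> M" using r prime_mult_iff[OF M] by blast
    ultimately show "a' \<otimes> b' \<in> saturation R M K"
      using satI[of "r \<otimes> r" M "a' \<otimes> b'" K] r(1) c' by simp
  qed
  show ?thesis
  proof
    fix u assume u: "u \<in> P"
    then have "u \<in> saturation R M K" using PL LAB \<open>A \<cdot> B \<subseteq> saturation R M K\<close> by blast
    then obtain s where s: "s \<in> carrier R" "s \<notin> M" "s \<otimes> u \<in> K" by (rule satE)
    obtain q t where q: "q \<in> M \<cdot> P" "t \<in> carrier R" "s \<otimes> u = q \<oplus> t \<otimes> (a \<otimes> b)"
      using s(3) unfolding K_def by (rule add_principal_memE)
    have "q \<in> P" using q(1) ideal_prod_inter[OF Mi Pi] by blast
    moreover have "s \<otimes> u \<in> P" by (rule ideal_l[OF Pi u s(1)])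
    ultimately have "t \<otimes> (a \<otimes> b) \<in> P"
      unfolding q(3) using ideal_add_cancel[OF Pi, of q "t \<otimes> (a \<otimes> b)"] q(2) c by simp
    \<comment> \<open>The coefficient of ab has fallen into P, so t(ab) = a(bt) is already in MP and
      the generator ab of K is no longer needed for su.\<close>
    then have tP: "t \<in> P" using prime_mult_iff[OF P q(2), of "a \<otimes> b"] abP c by simp
    have "a \<otimes> (b \<otimes> t) \<in> M \<cdot> P"
      using prod_memI[of a M "b \<otimes> t" P] a A(2) ideal_l[OF Pi tP c(2)] by blast
    moreover have "a \<otimes> (b \<otimes> t) = t \<otimes> (a \<otimes> b)" using c q(2) by algebra
    ultimately have "s \<otimes> u \<in> M \<cdot> P" unfolding q(3) using ideal_add[OF MPi q(1)] by simp
    then show "u \<in> saturation R M (M \<cdot> P)" by (rule satI[OF s(1,2) pc[OF u]])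
  qed
qed

text \<open>Iterating the local inclusion of P in MP gives M^n P, and only the containment in M^n is
  retained.\<close>

lemma prime_subset_sat_power:
  assumes P: "primeideal P R" and M: "primeideal M R" and s: "P \<subseteq> saturation R M (M \<cdot> P)"
  shows "P \<subseteq> saturation R M (ideal_power M n)"
proof -
  note Pi = prime_ideal[OF P] and Mi = prime_ideal[OF M]
  have "P \<subseteq> saturation R M (ideal_power M n \<cdot> P)"
  proof (induct n)
    case 0
    have "carrier R \<cdot> P = P" using ideal_prod_one[OF Pi] ideal_prod_commute[OF Pi oneideal] by simp
    then show ?case using sat_superset[OF M Pi] by simp
  next
    case (Suc n)
    note Mn = ideal_power_ideal[OF Mi, of n]
    have "ideal_power M n \<cdot> P \<subseteq> saturation R M (ideal_power M n \<cdot> (M \<cdot> P))"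
      by (rule sat_prod[OF M Mn ideal_prod_is_ideal[OF Mi Pi] sat_superset[OF M Mn] s])
    also have "ideal_power M n \<cdot> (M \<cdot> P) = ideal_power M (Suc n) \<cdot> P"
      using ideal_prod_assoc[OF Mn Mi Pi] by simp
    finally show ?case by (rule sat_trans[OF M Suc])
  qed
  also have "ideal_power M n \<cdot> P \<subseteq> ideal_power M n"
    using ideal_prod_inter[OF ideal_power_ideal[OF Mi] Pi] by blast
  then have "saturation R M (ideal_power M n \<cdot> P) \<subseteq> saturation R M (ideal_power M n)"
    by (rule sat_mono)
  finally show ?thesis .
qed

text \<open>Locally at \<open>M\<close>, the prime \<open>P\<close> lies in every power of \<open>M\<close>, hence in \<open>(x\<^sup>2, y\<^sup>2)\<close> and then in
  \<open>(y\<^sup>2)\<close>. A 2-absorbing factor \<open>J \<subseteq> P\<close> of \<open>(u)\<close> then satisfies \<open>J = yJ\<close>, whence \<open>(u) = y(u)\<close>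
  and \<open>u = 0\<close>.\<close>

lemma TAF_prime_sat_zero:
  assumes TAF: "TAF_ring R" and P: "primeideal P R" and M: "primeideal M R" and PM: "P \<subseteq> M"
    and xP: "x \<in> P" and yM: "y \<in> M" "y \<notin> P"
    and min: "\<And>Q. primeideal Q R \<Longrightarrow> x \<in> Q \<Longrightarrow> y \<in> Q \<Longrightarrow> Q \<subseteq> M \<Longrightarrow> Q = M"
  shows "P \<subseteq> saturation R M {\<zero>}"
proof -
  note Pi = prime_ideal[OF P] and Mi = prime_ideal[OF M]
  note pc = ideal_carr[OF Pi] and mc = ideal_carr[OF Mi]
  have yc: "y \<in> carrier R" and xc: "x \<in> carrier R" using mc pc yM xP by auto
  have xM: "x \<in> M" using xP PM by blast
  define z where "z = y \<otimes> y"
  have zc: "z \<in> carrier R" unfolding z_def using yc by simp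
  have xi: "ideal (PIdl (x \<otimes> x)) R" and zi: "ideal (PIdl z) R" using cgenideal_ideal xc zc by auto
  \<comment> \<open>The square on x lets x be eliminated: locally x = cx^2 + ry^2, and (1 - cx)x =
    ry^2 with 1 - cx a unit. The square on y is what the absorbing property acts on further
    below.\<close>
  define K where "K = PIdl (x \<otimes> x) <+> PIdl z"
  have Ki: "ideal K R" unfolding K_def by (rule add_principal_ideal[OF xi zc])
  have KM: "K \<subseteq> M"
    unfolding K_def z_def
    by (intro add_principal_subset[OF Mi] cgenideal_minimal[OF Mi] ideal_l[OF Mi] xM yM xc yc)
  have "minimal_prime_over R K M"
    unfolding minimal_prime_over_def
  proof (intro conjI allI impI)
    fix Q assume Q: "primeideal Q R \<and> K \<subseteq> Q \<and> Q \<subseteq> M"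
    then have "x \<otimes> x \<in> Q" "z \<in> Q"
      using add_principal_self[OF xi zc] cgenideal_self[of "x \<otimes> x"] xc unfolding K_def by auto
    then have "x \<in> Q" "y \<in> Q" unfolding z_def using prime_mult_iff[of Q] Q xc yc by auto
    then show "Q = M" using min[of Q] Q by simp
  qed (use M KM in auto)
  then obtain n where n: "ideal_power M n \<subseteq> saturation R M K"
    by (rule TAF_minimal_prime_power[OF TAF Ki])
  have "P \<subseteq> saturation R M (ideal_power M n)"
    by (rule prime_subset_sat_power[OF P M TAF_prime_subset_sat_mult[OF TAF P M PM xP yM min]])
  then have PK: "P \<subseteq> saturation R M K" by (rule sat_trans[OF M _ n])
  have zS: "ideal (saturation R M (PIdl z)) R" by (rule sat_ideal[OF M zi])
  have "x \<in> saturation R M (PIdl z)"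
  proof -
    have "x \<in> saturation R M K" using PK xP by blast
    then obtain s where s: "s \<in> carrier R" "s \<notin> M" "s \<otimes> x \<in> K" by (rule satE)
    obtain q r where q: "q \<in> PIdl (x \<otimes> x)" and r: "r \<in> carrier R" "s \<otimes> x = q \<oplus> r \<otimes> z"
      using s(3) unfolding K_def by (rule add_principal_memE)
    obtain c where c: "c \<in> carrier R" "q = c \<otimes> (x \<otimes> x)" using q by (rule cgenidealE)
    have "(s \<ominus> c \<otimes> x) \<otimes> x = s \<otimes> x \<ominus> q" unfolding c(2) using s(1) c(1) xc by algebra
    also have "\<dots> = r \<otimes> z" unfolding r(2) c(2) using c(1) xc r(1) zc by algebra
    finally have "(s \<ominus> c \<otimes> x) \<otimes> x \<in> PIdl z" using cgenidealI[OF r(1)] by simp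
    then show ?thesis
      using satI[OF _ prime_minus_notin[OF M s(1,2) ideal_l[OF Mi xM c(1)]] xc] s(1) c(1) xc by simp
  qed
  then have "x \<otimes> x \<in> saturation R M (PIdl z)" by (rule ideal_l[OF zS _ xc])
  moreover have "z \<in> saturation R M (PIdl z)" using sat_superset[OF M zi] cgenideal_self[OF zc] by blast
  ultimately have "K \<subseteq> saturation R M (PIdl z)"
    unfolding K_def by (intro add_principal_subset[OF zS] cgenideal_minimal[OF zS])
  then have Pz: "P \<subseteq> saturation R M (PIdl z)" by (rule sat_trans[OF M PK])
  show ?thesis
  proof
    fix u assume u: "u \<in> P"
    note uc = pc[OF u]
    have ui: "ideal (PIdl u) R" and yi: "ideal (PIdl y) R" using cgenideal_ideal uc yc by auto
    obtain J L where J: "TA_ideal R J" "J \<subseteq> P" and Li: "ideal L R" and uJL: "PIdl u = J \<cdot> L"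
      by (rule TAF_factor_in_prime[OF TAF ui P cgenideal_minimal[OF Pi u]])
    note Ji = TA_ideal_ideal[OF J(1)]
    have yJi: "ideal ((PIdl y) \<cdot> J) R" by (rule ideal_prod_is_ideal[OF yi Ji])
    \<comment> \<open>Locally j = ey^2. In the product y y e of J the pair y^2 is not in P and so
      not in J; hence ye is in J, and j = y(ye) lies in yJ.\<close>
    have JyJ: "J \<subseteq> saturation R M ((PIdl y) \<cdot> J)"
    proof
      fix j assume j: "j \<in> J"
      note jc = ideal_carr[OF Ji j]
      have "j \<in> saturation R M (PIdl z)" using j J(2) Pz by blast
      then obtain s where s: "s \<in> carrier R" "s \<notin> M" "s \<otimes> j \<in> PIdl z" by (rule satE)
      obtain e where e: "e \<in> carrier R" "s \<otimes> j = e \<otimes> z" using s(3) by (rule cgenidealE)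
      have sj: "s \<otimes> j = y \<otimes> y \<otimes> e" unfolding e(2) z_def using e(1) yc by algebra
      have "y \<otimes> y \<otimes> e \<in> J" unfolding sj[symmetric] by (rule ideal_l[OF Ji j s(1)])
      moreover have "y \<otimes> y \<notin> J" using J(2) prime_mult_iff[OF P yc yc] yM(2) by blast
      ultimately have "y \<otimes> e \<in> J" using TA_idealD[OF J(1) yc yc e(1)] by blast
      then have "y \<otimes> (y \<otimes> e) \<in> (PIdl y) \<cdot> J" by (rule prod_memI[OF cgenideal_self[OF yc]])
      then have "s \<otimes> j \<in> (PIdl y) \<cdot> J" unfolding sj using yc e(1) m_assoc by simp
      then show "j \<in> saturation R M ((PIdl y) \<cdot> J)" by (rule satI[OF s(1,2) jc])
    qed
    have yui: "ideal (PIdl (y \<otimes> u)) R" using cgenideal_ideal uc yc by simp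
    \<comment> \<open>Multiplying the local inclusion of J in yJ by L turns it into an inclusion of
      (u) in (yu). As (u) is principal, this is an equation su = tyu, and s - ty is outside
      M.\<close>
    have "PIdl u \<subseteq> saturation R M (((PIdl y) \<cdot> J) \<cdot> L)"
      unfolding uJL by (rule sat_prod[OF M yJi Li JyJ sat_superset[OF M Li]])
    also have "((PIdl y) \<cdot> J) \<cdot> L = (PIdl y) \<cdot> (PIdl u)"
      unfolding uJL by (rule ideal_prod_assoc[OF yi Ji Li])
    also have "(PIdl y) \<cdot> (PIdl u) \<subseteq> PIdl (y \<otimes> u)"
    proof (rule prod_subsetI[OF yui])
      fix a b assume "a \<in> PIdl y" "b \<in> PIdl u"
      then obtain c d where cd: "c \<in> carrier R" "a = c \<otimes> y" "d \<in> carrier R" "b = d \<otimes> u"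
        by (meson cgenidealE)
      have "a \<otimes> b = (c \<otimes> d) \<otimes> (y \<otimes> u)" unfolding cd(2,4) using cd(1,3) yc uc by algebra
      then show "a \<otimes> b \<in> PIdl (y \<otimes> u)" using cgenidealI[of "c \<otimes> d"] cd by simp
    qed
    then have "saturation R M ((PIdl y) \<cdot> (PIdl u)) \<subseteq> saturation R M (PIdl (y \<otimes> u))" by (rule sat_mono)
    finally have "u \<in> saturation R M (PIdl (y \<otimes> u))" using cgenideal_self[OF uc] by blast
    then obtain s where s: "s \<in> carrier R" "s \<notin> M" "s \<otimes> u \<in> PIdl (y \<otimes> u)" by (rule satE)
    obtain t where t: "t \<in> carrier R" "s \<otimes> u = t \<otimes> (y \<otimes> u)" using s(3) by (rule cgenidealE)
    have "(s \<ominus> t \<otimes> y) \<otimes> u = s \<otimes> u \<ominus> t \<otimes> (y \<otimes> u)" using s(1) t(1) yc uc by algebra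
    also have "\<dots> = \<zero>" unfolding t(2) using t(1) yc uc by algebra
    finally have "(s \<ominus> t \<otimes> y) \<otimes> u \<in> {\<zero>}" by simp
    then show "u \<in> saturation R M {\<zero>}"
      using satI[OF _ prime_minus_notin[OF M s(1,2) ideal_l[OF Mi yM(1) t(1)]] uc] s(1) t(1) yc by simp
  qed
qed

section \<open>Dimension and minimal primes of TAF-rings\<close>

lemma prime_avoiding_element:
  assumes P: "primeideal P R" and I: "ideal I R" "\<not> I \<subseteq> P" and F: "finite F"
    "\<And>Q. Q \<in> F \<Longrightarrow> ideal Q R \<and> \<not> Q \<subseteq> P"
  shows "\<exists>c\<in>I. c \<notin> P \<and> (\<forall>Q\<in>F. c \<in> Q)"
  using F
proof (induct F rule: finite_induct)
  case empty
  then show ?case using I(2) by blast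
next
  case (insert Q F)
  then obtain c where c: "c \<in> I" "c \<notin> P" "\<forall>Q\<in>F. c \<in> Q" by auto
  have Q: "ideal Q R" "\<not> Q \<subseteq> P" using insert(4)[of Q] by auto
  then obtain q where q: "q \<in> Q" "q \<notin> P" by blast
  note cc = ideal_carr[OF I(1) c(1)] and qc = ideal_carr[OF Q(1) q(1)]
  have "q \<otimes> c \<in> I" by (rule ideal_l[OF I(1) c(1) qc])
  moreover have "q \<otimes> c \<notin> P" using prime_mult_iff[OF P qc cc] c q by simp
  moreover have "q \<otimes> c \<in> Q" by (rule ideal_r[OF Q(1) q(1) cc])
  moreover have "q \<otimes> c \<in> Q'" if "Q' \<in> F" for Q'
  proof -
    have "ideal Q' R" using insert(4)[of Q'] that by simp
    then show ?thesis using ideal_l[OF _ _ qc] c(3) that by simp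
  qed
  ultimately show ?case by auto
qed

text \<open>If the element a found for F lies in the new prime P, add to it some b in I that is in
  every member of F but not in P; incomparability provides b. Minimal primes over an ideal are
  pairwise incomparable.\<close>

lemma prime_avoidance:
  assumes F: "finite F" "\<And>P. P \<in> F \<Longrightarrow> primeideal P R" "\<And>P Q. P \<in> F \<Longrightarrow> Q \<in> F \<Longrightarrow> P \<subseteq> Q \<Longrightarrow> P = Q"
    and I: "ideal I R" "\<And>P. P \<in> F \<Longrightarrow> \<not> I \<subseteq> P"
  shows "\<exists>a\<in>I. \<forall>P\<in>F. a \<notin> P"
  using F I(2)
proof (induct F rule: finite_induct)
  case empty
  then show ?case using ideal_zero[OF I(1)] by blast
next
  case (insert P F)
  have P: "primeideal P R" and IP: "\<not> I \<subseteq> P" using insert(4,6) by auto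
  note Pi = prime_ideal[OF P]
  have "\<exists>a\<in>I. \<forall>P\<in>F. a \<notin> P"
    using insert(4-6) by (intro insert(3)) auto
  then obtain a where a: "a \<in> I" "\<forall>P\<in>F. a \<notin> P" by blast
  show ?case
  proof (cases "a \<in> P")
    case True
    have "ideal Q R \<and> \<not> Q \<subseteq> P" if "Q \<in> F" for Q
      using prime_ideal[OF insert(4)[of Q]] insert(5)[of Q P] insert(2) that by auto
    then obtain b where b: "b \<in> I" "b \<notin> P" "\<forall>Q\<in>F. b \<in> Q"
      using prime_avoiding_element[OF P I(1) IP insert(1)] by blast
    note c = ideal_carr[OF I(1) a(1)] ideal_carr[OF I(1) b(1)]
    have "a \<oplus> b \<in> I" by (rule ideal_add[OF I(1) a(1) b(1)])
    moreover have "a \<oplus> b \<notin> P" using ideal_add_cancel[OF Pi _ True c(2)] b(2) by blast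
    moreover have "a \<oplus> b \<notin> Q" if "Q \<in> F" for Q
    proof
      assume "a \<oplus> b \<in> Q"
      moreover have "ideal Q R" using prime_ideal[OF insert(4)[of Q]] that by simp
      moreover have "b \<in> Q" using b(3) that by blast
      ultimately have "a \<in> Q" using ideal_add_cancel' c(1) by blast
      then show False using a(2) that by blast
    qed
    ultimately show ?thesis by blast
  next
    case False
    then show ?thesis using a by blast
  qed
qed

lemma TAF_avoid_minimal_primes:
  assumes TAF: "TAF_ring R" "ideal I R" and J: "ideal J R"
    "\<And>P. minimal_prime_over R I P \<Longrightarrow> \<not> J \<subseteq> P"
  obtains a where "a \<in> J" "\<forall>P. minimal_prime_over R I P \<longrightarrow> a \<notin> P"
proof -
  have "\<exists>a\<in>J. \<forall>P\<in>{P. minimal_prime_over R I P}. a \<notin> P"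
  proof (rule prime_avoidance[OF TAF_finite_minimal_primes[OF TAF]])
    show "P = Q" if "P \<in> {P. minimal_prime_over R I P}" "Q \<in> {P. minimal_prime_over R I P}" "P \<subseteq> Q" for P Q
      using that unfolding minimal_prime_over_def by simp
  qed (use J in \<open>auto simp: minimal_prime_over_def\<close>)
  then show thesis using that by auto
qed

lemma zero_subset_ideal: "ideal I R \<Longrightarrow> {\<zero>} \<subseteq> I"
  using ideal_zero by blast

text \<open>Choose x in P1 outside all minimal primes, y in P2 outside all minimal primes over (x),
  then M inside P2 minimal over (x, y) and Q inside M minimal over (x). Since y is not in Q, the
  prime Q vanishes locally at M and so lies in every minimal prime N below it; but x is in Q and not
  in N.\<close>

lemma TAF_dim_le_1:
  assumes TAF: "TAF_ring R" and P: "primeideal P0 R" "primeideal P1 R" "primeideal P2 R"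
    and s: "P0 \<subset> P1" "P1 \<subset> P2"
  shows False
proof -
  note i1 = prime_ideal[OF P(2)] and i2 = prime_ideal[OF P(3)]
  have "\<not> P1 \<subseteq> Q" if "minimal_prime_over R {\<zero>} Q" for Q
  proof
    assume "P1 \<subseteq> Q"
    then have "P0 \<subseteq> Q" using s by blast
    then have "P0 = Q"
      using that P(1) zero_subset_ideal[OF prime_ideal[OF P(1)]] unfolding minimal_prime_over_def by simp
    then show False using s(1) \<open>P1 \<subseteq> Q\<close> by blast
  qed
  then obtain x where x: "x \<in> P1" "\<forall>Q. minimal_prime_over R {\<zero>} Q \<longrightarrow> x \<notin> Q"
    by (rule TAF_avoid_minimal_primes[OF TAF zeroideal i1])
  have xc: "x \<in> carrier R" by (rule ideal_carr[OF i1 x(1)])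
  have xi: "ideal (PIdl x) R" by (rule cgenideal_ideal[OF xc])
  have xP1: "PIdl x \<subseteq> P1" by (rule cgenideal_minimal[OF i1 x(1)])
  have "\<not> P2 \<subseteq> Q" if "minimal_prime_over R (PIdl x) Q" for Q
  proof
    assume "P2 \<subseteq> Q"
    then have "P1 \<subseteq> Q" using s by blast
    then have "P1 = Q" using that P(2) xP1 unfolding minimal_prime_over_def by simp
    then show False using s(2) \<open>P2 \<subseteq> Q\<close> by blast
  qed
  then obtain y where y: "y \<in> P2" "\<forall>Q. minimal_prime_over R (PIdl x) Q \<longrightarrow> y \<notin> Q"
    by (rule TAF_avoid_minimal_primes[OF TAF xi i2])
  have yc: "y \<in> carrier R" by (rule ideal_carr[OF i2 y(1)])
  define I where "I = (PIdl x) <+> (PIdl y)"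
  have Ii: "ideal I R" unfolding I_def by (rule add_principal_ideal[OF xi yc])
  have xI: "PIdl x \<subseteq> I" and yI: "y \<in> I" unfolding I_def using add_principal_self[OF xi yc] by auto
  have "PIdl x \<subseteq> P2" using xP1 s(2) by blast
  then have "I \<subseteq> P2" unfolding I_def by (rule add_principal_subset[OF i2 _ y(1)])
  then obtain M where M: "minimal_prime_over R I M" "M \<subseteq> P2"
    by (rule TAF_minimal_prime_below[OF TAF Ii P(3)])
  have Mp: "primeideal M R" and IM: "I \<subseteq> M"
    and Mmin: "\<And>T. primeideal T R \<Longrightarrow> I \<subseteq> T \<Longrightarrow> T \<subseteq> M \<Longrightarrow> T = M"
    using M(1) unfolding minimal_prime_over_def by auto
  have "PIdl x \<subseteq> M" using xI IM by blast
  \<comment> \<open>\<open>TAF_prime_sat_zero\<close> is applied to Q instead of P1, since M is only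
    known to contain x and y, not P1.\<close>
  then obtain Q where Q: "minimal_prime_over R (PIdl x) Q" "Q \<subseteq> M"
    by (rule TAF_minimal_prime_below[OF TAF xi Mp])
  have Qp: "primeideal Q R" and xQ: "PIdl x \<subseteq> Q" using Q(1) unfolding minimal_prime_over_def by auto
  have xQ': "x \<in> Q" using xQ cgenideal_self[OF xc] by blast
  have "Q \<subseteq> saturation R M {\<zero>}"
  proof (rule TAF_prime_sat_zero[OF TAF Qp Mp Q(2) xQ' _ y(2)[rule_format, OF Q(1)]])
    show "y \<in> M" using yI IM by blast
    fix T assume T: "primeideal T R" "x \<in> T" "y \<in> T" "T \<subseteq> M"
    note Ti = prime_ideal[OF T(1)]
    have "I \<subseteq> T" unfolding I_def
      by (intro add_principal_subset[OF Ti] cgenideal_minimal[OF Ti] T(2,3))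
    then show "T = M" by (rule Mmin[OF T(1) _ T(4)])
  qed
  moreover obtain N where N: "minimal_prime_over R {\<zero>} N" "N \<subseteq> Q"
    by (rule TAF_minimal_prime_below[OF TAF zeroideal Qp zero_subset_ideal[OF prime_ideal[OF Qp]]])
  moreover have "saturation R M {\<zero>} \<subseteq> N"
    using N Q(2) by (intro sat_subset_prime[OF Mp]) (auto simp: minimal_prime_over_def)
  ultimately have "x \<in> N" using xQ' by blast
  then show False using x(2)[rule_format, OF N(1)] by blast
qed

lemma TAF_nonmaximal_prime_minimal:
  assumes TAF: "TAF_ring R" and P: "primeideal P R" "primeideal M R" "P \<subset> M"
  shows "minimal_prime_over R {\<zero>} P"
  unfolding minimal_prime_over_def
proof (intro conjI allI impI)
  show "{\<zero>} \<subseteq> P" by (rule zero_subset_ideal[OF prime_ideal[OF P(1)]])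
  fix Q assume "primeideal Q R \<and> {\<zero>} \<subseteq> Q \<and> Q \<subseteq> P"
  then show "Q = P" using TAF_dim_le_1[OF TAF _ P(1,2) _ P(3), of Q] by auto
qed (rule P(1))

text \<open>Take x = 0 and y in M outside all minimal primes. A prime strictly inside M is minimal
  and so misses y; hence M is minimal over (y).\<close>

lemma TAF_prime_sat_zero':
  assumes TAF: "TAF_ring R" and P: "primeideal P R" "primeideal M R" "P \<subset> M"
  shows "P \<subseteq> saturation R M {\<zero>}"
proof -
  note Pi = prime_ideal[OF P(1)] and Mi = prime_ideal[OF P(2)]
  have "\<not> M \<subseteq> Q" if "minimal_prime_over R {\<zero>} Q" for Q
  proof
    assume "M \<subseteq> Q"
    then have "P = Q" using that P zero_subset_ideal[OF Pi] unfolding minimal_prime_over_def by auto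
    then show False using P(3) \<open>M \<subseteq> Q\<close> by blast
  qed
  then obtain y where y: "y \<in> M" "\<forall>Q. minimal_prime_over R {\<zero>} Q \<longrightarrow> y \<notin> Q"
    by (rule TAF_avoid_minimal_primes[OF TAF zeroideal Mi])
  have yP: "y \<notin> P" by (rule y(2)[rule_format, OF TAF_nonmaximal_prime_minimal[OF TAF P]])
  have PM: "P \<subseteq> M" using P(3) by blast
  show ?thesis
  proof (rule TAF_prime_sat_zero[OF TAF P(1,2) PM ideal_zero[OF Pi] y(1) yP])
    fix T assume T: "primeideal T R" "y \<in> T" "T \<subseteq> M"
    show "T = M"
    proof (rule ccontr)
      assume "T \<noteq> M"
      then have "minimal_prime_over R {\<zero>} T" using TAF_nonmaximal_prime_minimal[OF TAF T(1) P(2)] T(3) by blast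
      then show False using y(2) T(2) by blast
    qed
  qed
qed

text \<open>If P is strictly below M, it vanishes locally at M and therefore lies in Q. This is
  comaximality of distinct minimal primes, because in a TAF-ring a proper ideal such as P + Q lies
  in some prime M.\<close>

lemma TAF_minimal_primes_comaximal:
  assumes TAF: "TAF_ring R" and P: "minimal_prime_over R {\<zero>} P" and Q: "minimal_prime_over R {\<zero>} Q"
    and M: "primeideal M R" "P \<subseteq> M" "Q \<subseteq> M"
  shows "P = Q"
proof (cases "P = M")
  case True
  then show ?thesis using M P Q unfolding minimal_prime_over_def by auto
next
  case False
  have p: "primeideal P R" "primeideal Q R" "{\<zero>} \<subseteq> Q" "{\<zero>} \<subseteq> P" using P Q unfolding minimal_prime_over_def by auto
  have "P \<subseteq> saturation R M {\<zero>}" using TAF_prime_sat_zero'[OF TAF p(1) M(1)] M(2) False by blast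
  also have "\<dots> \<subseteq> Q" by (rule sat_subset_prime[OF M(1) p(2) M(3) p(3)])
  finally show ?thesis using p(1,4) Q unfolding minimal_prime_over_def by simp
qed

lemma TAF_nonmaximal_below_prime:
  assumes TAF: "TAF_ring R" and P: "primeideal P R" "\<not> maximalideal P R"
  obtains M where "primeideal M R" "P \<subset> M"
proof -
  obtain J where J: "ideal J R" "P \<subseteq> J" "J \<noteq> P" "J \<noteq> carrier R"
    using P(2) maximalidealI[OF prime_ideal[OF P(1)] primeideal.I_notcarr[OF P(1)]] by blast
  obtain M where "primeideal M R" "J \<subseteq> M" by (rule TAF_proper_in_prime[OF TAF J(1,4)])
  then show thesis using that J by blast
qed

text \<open>That the I P meet in zero is checked locally: if u is nonzero, its annihilator lies in a
  prime Q, and u does not vanish locally at any prime containing the annihilator. A minimal prime P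
  inside Q leads to such a prime at which I P does vanish: P itself if it is maximal, a prime
  strictly above P otherwise.\<close>

lemma TAF_components:
  assumes TAF: "TAF_ring R"
  obtains I where
    "\<forall>P. minimal_prime_over R {\<zero>} P \<longrightarrow> ideal (I P) R"
    "\<forall>P. minimal_prime_over R {\<zero>} P \<longrightarrow> \<not> maximalideal P R \<longrightarrow> I P = P"
    "\<forall>P. minimal_prime_over R {\<zero>} P \<longrightarrow> maximalideal P R \<longrightarrow> (\<exists>n>0. I P = ideal_power P n)"
    "\<forall>P Q. minimal_prime_over R {\<zero>} P \<longrightarrow> minimal_prime_over R {\<zero>} Q \<longrightarrow> P \<noteq> Q \<longrightarrow>
      I P <+> I Q = carrier R"
    "\<forall>u\<in>carrier R. (\<forall>P. minimal_prime_over R {\<zero>} P \<longrightarrow> u \<in> I P) \<longrightarrow> u = \<zero>"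
proof -
  \<comment> \<open>The exponent is made visibly positive, so that the power lies in P; the power
    with exponent 0 is the whole ring.\<close>
  have "\<exists>n>0. ideal_power P n \<subseteq> saturation R P {\<zero>}" if P: "minimal_prime_over R {\<zero>} P" for P
  proof -
    have Pp: "primeideal P R" using P unfolding minimal_prime_over_def by simp
    obtain n where n: "ideal_power P n \<subseteq> saturation R P {\<zero>}"
      by (rule TAF_minimal_prime_power[OF TAF zeroideal P])
    have "ideal_power P (Suc n) \<subseteq> ideal_power P n"
      using ideal_prod_inter[OF ideal_power_ideal prime_ideal, OF prime_ideal, OF Pp Pp, of n] by simp
    then show ?thesis using n by (intro exI[of _ "Suc n"]) auto
  qed
  then obtain n where n: "\<And>P. minimal_prime_over R {\<zero>} P \<Longrightarrow> 0 < n P \<and> ideal_power P (n P) \<subseteq> saturation R P {\<zero>}"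
    by metis
  define I where "I P = (if maximalideal P R then ideal_power P (n P) else P)" for P
  have Ii: "ideal (I P) R" if "minimal_prime_over R {\<zero>} P" for P
    using that ideal_power_ideal prime_ideal unfolding I_def minimal_prime_over_def by simp
  have Isub: "P \<subseteq> M" if "minimal_prime_over R {\<zero>} P" "primeideal M R" "I P \<subseteq> M" for P M
    using that prime_ideal_power_subset[OF that(2)] prime_ideal[of P]
    unfolding I_def minimal_prime_over_def by (simp split: if_splits)
  have nonmax: "I P = P" if "\<not> maximalideal P R" for P using that unfolding I_def by simp
  have max: "\<exists>n>0. I P = ideal_power P n" if "minimal_prime_over R {\<zero>} P" "maximalideal P R" for P
    using that n unfolding I_def by auto
  have comax: "I P <+> I Q = carrier R"
    if P: "minimal_prime_over R {\<zero>} P" and Q: "minimal_prime_over R {\<zero>} Q" and "P \<noteq> Q" for P Q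
  proof (rule ccontr)
    assume "I P <+> I Q \<noteq> carrier R"
    then obtain M where M: "primeideal M R" "I P <+> I Q \<subseteq> M"
      by (rule TAF_proper_in_prime[OF TAF add_ideals[OF Ii[OF P] Ii[OF Q]]])
    have "I P \<subseteq> I P <+> I Q" "I Q \<subseteq> I P <+> I Q"
      using union_genideal[OF Ii[OF P] Ii[OF Q]] genideal_self[of "I P \<union> I Q"]
        additive_subgroup.a_subset[OF ideal.axioms(1)[OF Ii[OF P]]]
        additive_subgroup.a_subset[OF ideal.axioms(1)[OF Ii[OF Q]]] by auto
    then have "P \<subseteq> M" "Q \<subseteq> M" using Isub[OF P M(1)] Isub[OF Q M(1)] M(2) by auto
    then show False using TAF_minimal_primes_comaximal[OF TAF P Q M(1)] \<open>P \<noteq> Q\<close> by blast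
  qed
  have zero: "u = \<zero>" if u: "u \<in> carrier R" "\<And>P. minimal_prime_over R {\<zero>} P \<Longrightarrow> u \<in> I P" for u
  proof (rule ccontr)
    assume "u \<noteq> \<zero>"
    define A where "A = {r \<in> carrier R. r \<otimes> u = \<zero>}"
    have Ai: "ideal A R" unfolding A_def
      by (rule idealI_elements) (use u(1) in \<open>auto simp: l_distr m_assoc\<close>)
    have "\<one> \<notin> A" unfolding A_def using u(1) \<open>u \<noteq> \<zero>\<close> by simp
    then have "A \<noteq> carrier R" using one_closed by blast
    then obtain Q where Q: "primeideal Q R" "A \<subseteq> Q" by (rule TAF_proper_in_prime[OF TAF Ai])
    have no: "u \<notin> saturation R M {\<zero>}" if "A \<subseteq> M" for M
      using that unfolding A_def saturation_def by auto
    obtain P where P: "minimal_prime_over R {\<zero>} P" "P \<subseteq> Q"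
      by (rule TAF_minimal_prime_below[OF TAF zeroideal Q(1) zero_subset_ideal[OF prime_ideal[OF Q(1)]]])
    have Pp: "primeideal P R" using P(1) unfolding minimal_prime_over_def by simp
    show False
    proof (cases "maximalideal P R")
      case True
      have "Q = P"
        using maximalideal.I_maximal[OF True prime_ideal[OF Q(1)] P(2)] prime_ideal[OF Q(1)]
          primeideal.I_notcarr[OF Q(1)] ideal_carr by blast
      moreover have "u \<in> saturation R P {\<zero>}" using u(2)[OF P(1)] n[OF P(1)] True unfolding I_def by auto
      ultimately show False using no Q(2) by blast
    next
      case False
      \<comment> \<open>\<open>TAF_prime_sat_zero'\<close> asks for a prime strictly above P. If Q =
        P, pass to a larger prime, which still contains the annihilator A.\<close>
      have "\<exists>M. primeideal M R \<and> P \<subset> M \<and> A \<subseteq> M"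
      proof (cases "Q = P")
        case True
        obtain M where "primeideal M R" "P \<subset> M" by (rule TAF_nonmaximal_below_prime[OF TAF Pp False])
        then show ?thesis using True Q by blast
      qed (use P(2) Q in blast)
      then obtain M where M: "primeideal M R" "P \<subset> M" "A \<subseteq> M" by blast
      have "u \<in> P" using u(2)[OF P(1)] False unfolding I_def by simp
      then show False using TAF_prime_sat_zero'[OF TAF Pp M(1,2)] no[OF M(3)] by blast
    qed
  qed
  show thesis
  proof (rule that[of I])
    show "\<forall>P. minimal_prime_over R {\<zero>} P \<longrightarrow> ideal (I P) R" by (intro allI impI Ii)
    show "\<forall>P. minimal_prime_over R {\<zero>} P \<longrightarrow> \<not> maximalideal P R \<longrightarrow> I P = P"
      by (intro allI impI nonmax)
    show "\<forall>P. minimal_prime_over R {\<zero>} P \<longrightarrow> maximalideal P R \<longrightarrow> (\<exists>n>0. I P = ideal_power P n)"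
      by (intro allI impI max)
    show "\<forall>P Q. minimal_prime_over R {\<zero>} P \<longrightarrow> minimal_prime_over R {\<zero>} Q \<longrightarrow> P \<noteq> Q \<longrightarrow>
      I P <+> I Q = carrier R"
      by (intro allI impI comax)
    show "\<forall>u\<in>carrier R. (\<forall>P. minimal_prime_over R {\<zero>} P \<longrightarrow> u \<in> I P) \<longrightarrow> u = \<zero>"
      by (intro ballI impI zero) blast+
  qed
qed

end

section \<open>Direct products\<close>

text \<open>Lets the quotients produced by the Chinese remainder theorem be replaced by isomorphic
  copies over the element type of R.\<close>

lemma RDirProd_list_iso_cong:
  "list_all2 (\<simeq>) Rs Ss \<Longrightarrow> RDirProd_list Rs \<simeq> RDirProd_list Ss"
proof (induct rule: list_all2_induct)
  case Nil
  have "(\<lambda>_. []) \<in> ring_iso (RDirProd_list []) (RDirProd_list [])"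
    unfolding ring_iso_def ring_hom_def bij_betw_def inj_on_def by (auto simp: monoid.defs)
  then show ?case unfolding is_ring_iso_def by blast
next
  case (Cons R Rs S Ss)
  then obtain f g where "f \<in> ring_iso R S" "g \<in> ring_iso (RDirProd_list Rs) (RDirProd_list Ss)"
    unfolding is_ring_iso_def by blast
  from ring_iso_set_trans[OF ring_iso_set_trans[OF RDirProd_list_iso2 RDirProd_iso6[OF this]] RDirProd_list_iso1]
  show ?case unfolding is_ring_iso_def by blast
qed

context cring
begin

lemma Quot_zero_iso: "R \<simeq> R Quot {\<zero>}"
proof -
  have h: "ring_hom_ring R R id"
    by (intro ring_hom_ringI2 ring_axioms ring_hom_memI) auto
  have "a_kernel R R id = {\<zero>}" unfolding a_kernel_def' by auto
  then have "R Quot {\<zero>} \<simeq> R" using ring_hom_ring.FactRing_iso[OF h] by simp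
  then show ?thesis using ring_iso_sym[OF ideal.quotient_is_ring[OF zeroideal]] by blast
qed

text \<open>A copy of the quotient on coset representatives, so that its elements have the type of
  those of \<^term>\<open>R\<close>.\<close>

lemma quotient_on_representatives:
  assumes I: "ideal I R"
  obtains S :: "'a ring" and h where "R Quot I \<simeq> S" "ring_hom_ring R S h" "h ` carrier R = carrier S"
    "cring S" "\<forall>a\<in>carrier R. h a = \<zero>\<^bsub>S\<^esub> \<longleftrightarrow> a \<in> I"
proof -
  define h where "h a = (SOME r. r \<in> I +> a)" for a
  have hmem: "h a \<in> I +> a" if "a \<in> carrier R" for a
    unfolding h_def using abelian_subgroup.a_rcos_self[OF ideal.axioms(1)[OF I, THEN abelian_subgroupI3[OF _ is_abelian_group]] that]
    by (rule someI)
  have coset: "I +> h a = I +> a" if "a \<in> carrier R" for a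
    using abelian_subgroup.a_repr_independence'[OF abelian_subgroupI3[OF ideal.axioms(1)[OF I] is_abelian_group] hmem[OF that] that]
    by simp
  have w: "weak_ring_morphism h I R"
  proof (rule weak_ring_morphismI[OF I])
    fix a b assume ab: "a \<in> carrier R" "b \<in> carrier R"
    have "h a = h b \<longleftrightarrow> I +> a = I +> b"
    proof
      assume "h a = h b"
      then show "I +> a = I +> b" using coset[OF ab(1)] coset[OF ab(2)] by simp
    qed (simp add: h_def)
    then show "h a = h b \<longleftrightarrow> a \<ominus> b \<in> I" using quotient_eq_iff_same_a_r_cos[OF I ab] by simp
  qed
  let ?S = "image_ring h R"
  have hom: "ring_hom_ring R ?S h" by (rule weak_ring_morphism_ring_hom[OF w])
  have surj: "h ` carrier R = carrier ?S" by (simp add: image_ring_carrier)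
  show thesis
  proof (rule that[of ?S h])
    show "R Quot I \<simeq> ?S" using weak_ring_morphism_is_iso[OF w] unfolding is_ring_iso_def by blast
    interpret S: ring ?S by (rule image_ring_is_ring[OF w])
    show "cring ?S"
    proof (rule cring.intro[OF S.ring_axioms], unfold_locales)
      fix x y assume "x \<in> carrier ?S" "y \<in> carrier ?S"
      then obtain a b where ab: "a \<in> carrier R" "x = h a" "b \<in> carrier R" "y = h b"
        unfolding surj[symmetric] by blast
      then show "x \<otimes>\<^bsub>?S\<^esub> y = y \<otimes>\<^bsub>?S\<^esub> x"
        using ring_hom_mult[OF ring_hom_ring.homh[OF hom] ab(1,3)]
          ring_hom_mult[OF ring_hom_ring.homh[OF hom] ab(3,1)] m_comm[OF ab(1,3)] by simp
    qed
    show "\<forall>a\<in>carrier R. h a = \<zero>\<^bsub>?S\<^esub> \<longleftrightarrow> a \<in> I"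
      using weak_ring_morphism_ker[OF w] ideal_carr[OF I] unfolding a_kernel_def' by auto
  qed (rule hom, rule surj)
qed

section \<open>Ideals along a surjective homomorphism\<close>

context
  fixes S :: "('c, 'd) ring_scheme" and h I
  assumes hom: "ring_hom_ring R S h" and surj: "h ` carrier R = carrier S" and S: "cring S"
    and ker: "\<forall>a\<in>carrier R. h a = \<zero>\<^bsub>S\<^esub> \<longleftrightarrow> a \<in> I"
begin

interpretation S: cring S by (rule S)

lemma hom_simps:
  "a \<in> carrier R \<Longrightarrow> h a \<in> carrier S"
  "a \<in> carrier R \<Longrightarrow> b \<in> carrier R \<Longrightarrow> h (a \<otimes> b) = h a \<otimes>\<^bsub>S\<^esub> h b"
  "a \<in> carrier R \<Longrightarrow> b \<in> carrier R \<Longrightarrow> h (a \<oplus> b) = h a \<oplus>\<^bsub>S\<^esub> h b"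
  "h \<zero> = \<zero>\<^bsub>S\<^esub>" "h \<one> = \<one>\<^bsub>S\<^esub>"
proof -
  note H = ring_hom_ring.homh[OF hom]
  show "a \<in> carrier R \<Longrightarrow> h a \<in> carrier S" by (rule ring_hom_closed[OF H])
  show "a \<in> carrier R \<Longrightarrow> b \<in> carrier R \<Longrightarrow> h (a \<otimes> b) = h a \<otimes>\<^bsub>S\<^esub> h b" by (rule ring_hom_mult[OF H])
  show "a \<in> carrier R \<Longrightarrow> b \<in> carrier R \<Longrightarrow> h (a \<oplus> b) = h a \<oplus>\<^bsub>S\<^esub> h b" by (rule ring_hom_add[OF H])
  show "h \<zero> = \<zero>\<^bsub>S\<^esub>" by (rule ring_hom_zero[OF H ring_axioms S.ring_axioms])
  show "h \<one> = \<one>\<^bsub>S\<^esub>" by (rule ring_hom_one[OF H])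
qed

lemma image_mem_iff:
  assumes J: "ideal J R" "I \<subseteq> J" and a: "a \<in> carrier R"
  shows "h a \<in> h ` J \<longleftrightarrow> a \<in> J"
proof
  assume "h a \<in> h ` J"
  then obtain j where j: "j \<in> J" "h a = h j" by blast
  note jc = ideal_carr[OF J(1) j(1)]
  have "h a = h (a \<ominus> j) \<oplus>\<^bsub>S\<^esub> h j"
    using hom_simps(3)[of "a \<ominus> j" j] a jc by (simp add: a_minus_def a_assoc l_neg)
  then have "h (a \<ominus> j) = \<zero>\<^bsub>S\<^esub>"
    using j(2) hom_simps(1)[of "a \<ominus> j"] hom_simps(1)[OF jc] a jc S.add.l_cancel_one' by auto
  then have "a \<ominus> j \<in> J" using ker J(2) a jc by auto
  then have "(a \<ominus> j) \<oplus> j \<in> J" by (rule ideal_add[OF J(1) _ j(1)])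
  moreover have "(a \<ominus> j) \<oplus> j = a" using a jc by algebra
  ultimately show "a \<in> J" by simp
qed blast

lemma image_ideal:
  assumes J: "ideal J R"
  shows "ideal (h ` J) S"
proof (rule S.idealI_elements)
  note jc = ideal_carr[OF J]
  show "h ` J \<subseteq> carrier S" using hom_simps(1) jc by blast
  show "\<zero>\<^bsub>S\<^esub> \<in> h ` J" using hom_simps(4) ideal_zero[OF J] by (metis image_eqI)
  show "a \<oplus>\<^bsub>S\<^esub> b \<in> h ` J" if "a \<in> h ` J" "b \<in> h ` J" for a b
  proof -
    obtain i j where ij: "i \<in> J" "a = h i" "j \<in> J" "b = h j" using \<open>a \<in> h ` J\<close> \<open>b \<in> h ` J\<close> by blast
    then have "a \<oplus>\<^bsub>S\<^esub> b = h (i \<oplus> j)" using hom_simps(3)[OF jc[OF ij(1)] jc[OF ij(3)]] by simp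
    then show ?thesis using ideal_add[OF J ij(1,3)] by blast
  qed
  show "r \<otimes>\<^bsub>S\<^esub> a \<in> h ` J" if ar: "a \<in> h ` J" "r \<in> carrier S" for a r
  proof -
    obtain i where i: "i \<in> J" "a = h i" using ar(1) by blast
    obtain s where s: "s \<in> carrier R" "r = h s" using ar(2) unfolding surj[symmetric] by blast
    have "r \<otimes>\<^bsub>S\<^esub> a = h (s \<otimes> i)" using hom_simps(2)[OF s(1) jc[OF i(1)]] i(2) s(2) by simp
    then show ?thesis using ideal_l[OF J i(1) s(1)] by blast
  qed
qed

lemma image_prime:
  assumes P: "primeideal P R" "I \<subseteq> P"
  shows "primeideal (h ` P) S"
proof (rule primeidealI[OF image_ideal[OF prime_ideal[OF P(1)]] S])
  note mem = image_mem_iff[OF prime_ideal[OF P(1)] P(2)]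
  have "\<one>\<^bsub>S\<^esub> \<notin> h ` P" using mem[OF one_closed] prime_one[OF P(1)] hom_simps(5) by simp
  then show "carrier S \<noteq> h ` P" using S.one_closed by blast
  fix x y assume xy: "x \<in> carrier S" "y \<in> carrier S" "x \<otimes>\<^bsub>S\<^esub> y \<in> h ` P"
  obtain a where a: "a \<in> carrier R" "x = h a" using xy(1) unfolding surj[symmetric] by blast
  obtain b where b: "b \<in> carrier R" "y = h b" using xy(2) unfolding surj[symmetric] by blast
  have "h (a \<otimes> b) \<in> h ` P" using hom_simps(2)[OF a(1) b(1)] a b xy(3) by simp
  then have "a \<otimes> b \<in> P" using mem[of "a \<otimes> b"] a b by simp
  then show "x \<in> h ` P \<or> y \<in> h ` P" using prime_mult_iff[OF P(1) a(1) b(1)] a b by blast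
qed

lemma preimage_prime:
  assumes T: "primeideal T S"
  shows "primeideal {r \<in> carrier R. h r \<in> T} R" "I \<subseteq> carrier R \<Longrightarrow> I \<subseteq> {r \<in> carrier R. h r \<in> T}"
    "h ` {r \<in> carrier R. h r \<in> T} = T"
proof -
  note Ti = S.prime_ideal[OF T]
  show "primeideal {r \<in> carrier R. h r \<in> T} R"
    by (rule ring_hom_ring.primeideal_vimage[OF hom is_cring T])
  show "I \<subseteq> {r \<in> carrier R. h r \<in> T}" if c: "I \<subseteq> carrier R"
  proof
    fix a assume a: "a \<in> I"
    then have "h a = \<zero>\<^bsub>S\<^esub>" using ker c by blast
    then show "a \<in> {r \<in> carrier R. h r \<in> T}" using a c S.ideal_zero[OF Ti] by auto
  qed
  show "h ` {r \<in> carrier R. h r \<in> T} = T"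
  proof
    show "T \<subseteq> h ` {r \<in> carrier R. h r \<in> T}"
    proof
      fix t assume t: "t \<in> T"
      then have "t \<in> h ` carrier R" unfolding surj by (rule S.ideal_carr[OF Ti])
      then show "t \<in> h ` {r \<in> carrier R. h r \<in> T}" using t by blast
    qed
  qed blast
qed

lemma preimage_strict_mono:
  assumes "primeideal T S" "primeideal U S" "T \<subset> U"
  shows "{r \<in> carrier R. h r \<in> T} \<subset> {r \<in> carrier R. h r \<in> U}"
proof -
  have "{r \<in> carrier R. h r \<in> T} \<noteq> {r \<in> carrier R. h r \<in> U}"
    using preimage_prime(3)[OF assms(1)] preimage_prime(3)[OF assms(2)] assms(3) by (metis psubset_eq)
  then show ?thesis using assms(3) by blast
qed

text \<open>This transfers nilpotency: the power on the left vanishes as soon as the power of J lies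
  in the kernel.\<close>

lemma image_power:
  assumes J: "ideal J R"
  shows "(h ` J) [^]\<^bsub>ideals_set S\<^esub> (n::nat) \<subseteq> h ` ideal_power J n"
proof (induct n)
  case 0
  then show ?case using surj by simp
next
  case (Suc n)
  note Jn = ideal_power_ideal[OF J, of n]
  have "((h ` J) [^]\<^bsub>ideals_set S\<^esub> n) \<cdot>\<^bsub>S\<^esub> (h ` J) \<subseteq> h ` (ideal_power J n \<cdot> J)"
  proof (rule S.prod_subsetI[OF image_ideal[OF ideal_prod_is_ideal[OF Jn J]]])
    fix a b assume a: "a \<in> (h ` J) [^]\<^bsub>ideals_set S\<^esub> n" and b: "b \<in> h ` J"
    obtain i where i: "i \<in> ideal_power J n" "a = h i" using Suc a by blast
    obtain j where j: "j \<in> J" "b = h j" using b by blast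
    have "a \<otimes>\<^bsub>S\<^esub> b = h (i \<otimes> j)"
      using hom_simps(2)[OF ideal_carr[OF Jn i(1)] ideal_carr[OF J j(1)]] i(2) j(2) by simp
    then show "a \<otimes>\<^bsub>S\<^esub> b \<in> h ` (ideal_power J n \<cdot> J)" using prod_memI[OF i(1) j(1)] by blast
  qed
  then show ?case by simp
qed

end

end

section \<open>Krull dimension and height\<close>

lemma prime_chain_single: "primeideal P R \<Longrightarrow> prime_chain R 0 (\<lambda>_. P)"
  unfolding prime_chain_def by simp

lemma prime_chain_pair:
  "primeideal P R \<Longrightarrow> primeideal Q R \<Longrightarrow> P \<subset> Q \<Longrightarrow> prime_chain R (Suc 0) (\<lambda>i. if i = 0 then P else Q)"
  unfolding prime_chain_def by auto

lemma prime_chain_step: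
  "prime_chain R n P \<Longrightarrow> i < n \<Longrightarrow> primeideal (P i) R \<and> primeideal (P (Suc i)) R \<and> P i \<subset> P (Suc i)"
  unfolding prime_chain_def by auto

lemma krull_dim_eq_0:
  assumes "primeideal P R" and "\<And>P Q. primeideal P R \<Longrightarrow> primeideal Q R \<Longrightarrow> \<not> P \<subset> Q"
  shows "krull_dim R = 0"
proof -
  have "{n. \<exists>P. prime_chain R n P} = {0}"
  proof
    show "{n. \<exists>P. prime_chain R n P} \<subseteq> {0}"
    proof
      fix n assume "n \<in> {n. \<exists>P. prime_chain R n P}"
      then obtain C where C: "prime_chain R n C" by blast
      have "\<not> 0 < n" using prime_chain_step[OF C] assms(2) by blast
      then show "n \<in> {0}" by simp
    qed
  qed (use prime_chain_single[OF assms(1)] in blast)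
  then show ?thesis unfolding krull_dim_def by simp
qed

lemma krull_dim_eq_1:
  assumes "primeideal P R" "primeideal Q R" "P \<subset> Q"
    and "\<And>P Q T. primeideal P R \<Longrightarrow> primeideal Q R \<Longrightarrow> primeideal T R \<Longrightarrow> P \<subset> Q \<Longrightarrow> \<not> Q \<subset> T"
  shows "krull_dim R = 1"
proof -
  have "{n. \<exists>P. prime_chain R n P} = {0, 1}"
  proof
    show "{n. \<exists>P. prime_chain R n P} \<subseteq> {0, 1}"
    proof
      fix n assume "n \<in> {n. \<exists>P. prime_chain R n P}"
      then obtain C where C: "prime_chain R n C" by blast
      have "\<not> 1 < n"
      proof
        assume "1 < n"
        then show False
          using prime_chain_step[OF C, of 0] prime_chain_step[OF C, of "Suc 0"]
            assms(4)[of "C 0" "C (Suc 0)" "C (Suc (Suc 0))"] by simp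
      qed
      then show "n \<in> {0, 1}" by auto
    qed
    show "{0, 1} \<subseteq> {n. \<exists>P. prime_chain R n P}"
      using prime_chain_single[OF assms(1)] prime_chain_pair[OF assms(1-3)] by auto
  qed
  then show ?thesis unfolding krull_dim_def by (simp add: sup_max zero_ereal_def one_ereal_def)
qed

lemma krull_dim_1_pair:
  assumes "krull_dim R = 1"
  obtains P Q where "primeideal P R" "primeideal Q R" "P \<subset> Q"
proof -
  have "\<exists>n>0. \<exists>P. prime_chain R n P"
  proof (rule ccontr)
    assume "\<not> ?thesis"
    then have "krull_dim R \<le> 0"
      unfolding krull_dim_def by (intro SUP_least) (auto simp: zero_ereal_def)
    then show False using assms by simp
  qed
  then obtain n C where "0 < n" "prime_chain R n C" by blast
  then show thesis using that prime_chain_step[of R n C 0] by blast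
qed

lemma (in cring) minimal_prime_height:
  assumes P: "minimal_prime_over R {\<zero>} P"
  shows "prime_height R P = 0"
proof -
  have Pp: "primeideal P R" using P unfolding minimal_prime_over_def by simp
  have "{n. \<exists>C. prime_chain R n C \<and> C n = P} = {0}"
  proof
    show "{n. \<exists>C. prime_chain R n C \<and> C n = P} \<subseteq> {0}"
    proof
      fix n assume "n \<in> {n. \<exists>C. prime_chain R n C \<and> C n = P}"
      then obtain C where C: "prime_chain R n C" "C n = P" by blast
      show "n \<in> {0}"
      proof (cases n)
        case (Suc k)
        then have "primeideal (C k) R" "C k \<subset> P" using prime_chain_step[OF C(1), of k] C(2) by auto
        then show ?thesis
          using P zero_subset_ideal[OF prime_ideal] unfolding minimal_prime_over_def by blast
      qed simp
    qed
  qed (use prime_chain_single[OF Pp] in auto)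
  then show ?thesis unfolding prime_height_def by simp
qed

context cring
begin

section \<open>The components of a TAF-ring\<close>

text \<open>The kernel P maps onto the zero ideal, which is thus prime, and a prime strictly above P
  has a nonzero prime image. A chain of three primes of S would pull back to one of R.\<close>

lemma TAF_domain_component:
  assumes TAF: "TAF_ring R" and P: "primeideal P R" "\<not> maximalideal P R"
    and S: "ring_hom_ring R S h" "h ` carrier R = carrier S" "cring S"
    and ker: "\<forall>a\<in>carrier R. h a = \<zero>\<^bsub>S\<^esub> \<longleftrightarrow> a \<in> P"
  shows "domain S \<and> krull_dim S = 1"
proof
  interpret S: cring S by (rule S(3))
  note c = S ker
  have "h ` P = {\<zero>\<^bsub>S\<^esub>}"
    using ker ideal_carr[OF prime_ideal[OF P(1)]] ideal_zero[OF prime_ideal[OF P(1)]] by force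
  then have z: "primeideal {\<zero>\<^bsub>S\<^esub>} S" using image_prime[OF c P(1)] by simp
  then show "domain S" by (rule S.zeroprimeideal_domainI)
  obtain M where M: "primeideal M R" "P \<subset> M" by (rule TAF_nonmaximal_below_prime[OF TAF P])
  then have hM: "primeideal (h ` M) S" using image_prime[OF c M(1)] by blast
  obtain m where m: "m \<in> M" "m \<notin> P" using M(2) by blast
  then have "h m \<noteq> \<zero>\<^bsub>S\<^esub>" using ker ideal_carr[OF prime_ideal[OF M(1)]] by blast
  then have "{\<zero>\<^bsub>S\<^esub>} \<noteq> h ` M" using m(1) by blast
  then have s: "{\<zero>\<^bsub>S\<^esub>} \<subset> h ` M" using S.zero_subset_ideal[OF S.prime_ideal[OF hM]] by blast
  show "krull_dim S = 1"
  proof (rule krull_dim_eq_1[OF z hM s])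
    fix T U V assume T: "primeideal T S" "primeideal U S" "primeideal V S" "T \<subset> U"
    show "\<not> U \<subset> V"
      using TAF_dim_le_1[OF TAF preimage_prime(1)[OF c T(1)] preimage_prime(1)[OF c T(2)]
          preimage_prime(1)[OF c T(3)] preimage_strict_mono[OF c T(1,2,4)]]
        preimage_strict_mono[OF c T(2,3)] by blast
  qed
qed

lemma local_component:
  assumes P: "maximalideal P R" and n: "I = ideal_power P n" "0 < n"
    and S: "ring_hom_ring R S h" "h ` carrier R = carrier S" "cring S"
    and ker: "\<forall>a\<in>carrier R. h a = \<zero>\<^bsub>S\<^esub> \<longleftrightarrow> a \<in> I"
  shows "local_ring S \<and> krull_dim S = 0 \<and> (\<forall>M. maximalideal M S \<longrightarrow> nilpotent_ideal S M)"
proof -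
  interpret S: cring S by (rule S(3))
  note c = S ker
  have Pp: "primeideal P R" by (rule maximalideal_prime[OF P])
  note Pi = prime_ideal[OF Pp]
  have IP: "I \<subseteq> P" unfolding n(1) by (rule ideal_power_subset[OF Pi n(2)])
  have Ii: "ideal I R" unfolding n(1) by (rule ideal_power_ideal[OF Pi])
  have Ic: "I \<subseteq> carrier R" using ideal_carr[OF Ii] by blast
  have hP: "primeideal (h ` P) S" by (rule image_prime[OF c Pp IP])
  have only: "T = h ` P" if T: "primeideal T S" for T
  proof -
    let ?T = "{r \<in> carrier R. h r \<in> T}"
    have Tp: "primeideal ?T R" by (rule preimage_prime(1)[OF c T])
    have "ideal_power P n \<subseteq> ?T" using preimage_prime(2)[OF c T Ic] n(1) by simp
    then have "P \<subseteq> ?T" by (rule prime_ideal_power_subset[OF Tp Pi])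
    then have "?T = P"
      using maximalideal.I_maximal[OF P prime_ideal[OF Tp]] primeideal.I_notcarr[OF Tp] by blast
    then show ?thesis using preimage_prime(3)[OF c T] by simp
  qed
  have "maximalideal (h ` P) S"
  proof (rule maximalidealI)
    show "ideal (h ` P) S" by (rule S.prime_ideal[OF hP])
    show "carrier S \<noteq> h ` P" by (rule primeideal.I_notcarr[OF hP])
    fix J assume J: "ideal J S" "h ` P \<subseteq> J" "J \<subseteq> carrier S"
    have Ji: "ideal {r \<in> carrier R. h r \<in> J} R" by (rule ring_hom_ring.ideal_vimage[OF S(1) J(1)])
    have "P \<subseteq> {r \<in> carrier R. h r \<in> J}" using ideal_carr[OF Pi] J(2) by blast
    then consider "{r \<in> carrier R. h r \<in> J} = P" | "{r \<in> carrier R. h r \<in> J} = carrier R"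
      using maximalideal.I_maximal[OF P Ji] by blast
    then show "J = h ` P \<or> J = carrier S"
    proof cases
      case 1
      have "J \<subseteq> h ` P"
      proof
        fix x assume x: "x \<in> J"
        then obtain r where "r \<in> carrier R" "x = h r" using J(3) S(2) by blast
        then show "x \<in> h ` P" using 1 x by blast
      qed
      then show ?thesis using J(2) by blast
    next
      case 2
      have "carrier S \<subseteq> J" unfolding S(2)[symmetric] using 2 by blast
      then show ?thesis using J(3) by blast
    qed
  qed
  moreover have max: "M = h ` P" if "maximalideal M S" for M
    by (rule only[OF S.maximalideal_prime[OF that]])
  ultimately have "local_ring S" unfolding local_ring_def using S(3) by blast
  moreover have "krull_dim S = 0" by (rule krull_dim_eq_0[OF hP]) (use only in blast)
  moreover have "nilpotent_ideal S (h ` P)"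
    unfolding nilpotent_ideal_def
  proof (intro conjI exI)
    show "ideal (h ` P) S" by (rule S.prime_ideal[OF hP])
    have "(h ` P) [^]\<^bsub>ideals_set S\<^esub> n \<subseteq> h ` I" unfolding n(1) by (rule image_power[OF c Pi])
    also have "h ` I \<subseteq> {\<zero>\<^bsub>S\<^esub>}" using ker Ic by blast
    finally show "(h ` P) [^]\<^bsub>ideals_set S\<^esub> n = {\<zero>\<^bsub>S\<^esub>}"
      using S.zero_subset_ideal[OF S.ideal_power_ideal[OF S.prime_ideal[OF hP]]] by blast
  qed
  ultimately show ?thesis using max by blast
qed

lemma TAF_component_ring:
  assumes TAF: "TAF_ring R" and P: "minimal_prime_over R {\<zero>} P"
    and I: "ideal I R" "\<not> maximalideal P R \<Longrightarrow> I = P"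
      "maximalideal P R \<Longrightarrow> \<exists>n>0. I = ideal_power P n"
  obtains S :: "'a ring" where "R Quot I \<simeq> S"
    "(domain S \<and> krull_dim S = 1) \<or>
     (local_ring S \<and> krull_dim S = 0 \<and> (\<forall>M. maximalideal M S \<longrightarrow> nilpotent_ideal S M))"
proof -
  obtain S :: "'a ring" and h where S: "R Quot I \<simeq> S" "ring_hom_ring R S h" "h ` carrier R = carrier S"
    "cring S" "\<forall>a\<in>carrier R. h a = \<zero>\<^bsub>S\<^esub> \<longleftrightarrow> a \<in> I"
    by (rule quotient_on_representatives[OF I(1)])
  have Pp: "primeideal P R" using P unfolding minimal_prime_over_def by simp
  show thesis
  proof (cases "maximalideal P R")
    case True
    then obtain n where n: "0 < n" "I = ideal_power P n" using I(3) by blast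
    show thesis using that[OF S(1)] local_component[OF True n(2,1) S(2-5)] by blast
  next
    case False
    have "domain S \<and> krull_dim S = 1"
      using TAF_domain_component[OF TAF Pp False S(2-4)] S(5) I(2)[OF False] by simp
    then show thesis using that[OF S(1)] by blast
  qed
qed

section \<open>The product decomposition and the case of one height-zero prime\<close>

theorem TAF_direct_product:
  assumes TAF: "TAF_ring R"
  shows "\<exists>Rs :: 'a ring list. R \<simeq> RDirProd_list Rs \<and>
    (\<forall>S\<in>set Rs. (domain S \<and> krull_dim S = 1) \<or>
      (local_ring S \<and> krull_dim S = 0 \<and> (\<forall>M. maximalideal M S \<longrightarrow> nilpotent_ideal S M)))"
proof -
  obtain I where C: "\<forall>P. minimal_prime_over R {\<zero>} P \<longrightarrow> ideal (I P) R"
    "\<forall>P. minimal_prime_over R {\<zero>} P \<longrightarrow> \<not> maximalideal P R \<longrightarrow> I P = P"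
    "\<forall>P. minimal_prime_over R {\<zero>} P \<longrightarrow> maximalideal P R \<longrightarrow> (\<exists>n>0. I P = ideal_power P n)"
    "\<forall>P Q. minimal_prime_over R {\<zero>} P \<longrightarrow> minimal_prime_over R {\<zero>} Q \<longrightarrow> P \<noteq> Q \<longrightarrow>
      I P <+> I Q = carrier R"
    "\<forall>u\<in>carrier R. (\<forall>P. minimal_prime_over R {\<zero>} P \<longrightarrow> u \<in> I P) \<longrightarrow> u = \<zero>"
    by (rule TAF_components[OF TAF])
  note I = C[rule_format]
  let ?good = "\<lambda>S. (domain S \<and> krull_dim S = 1) \<or>
      (local_ring S \<and> krull_dim S = 0 \<and> (\<forall>M. maximalideal M S \<longrightarrow> nilpotent_ideal S M))"
  define comp where "comp P = (SOME S :: 'a ring. R Quot (I P) \<simeq> S \<and> ?good S)" for P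
  have comp: "R Quot (I P) \<simeq> comp P \<and> ?good (comp P)" if P: "minimal_prime_over R {\<zero>} P" for P
  proof -
    obtain S :: "'a ring" where S: "R Quot (I P) \<simeq> S" "?good S"
      by (rule TAF_component_ring[OF TAF P I(1)[OF P] I(2)[OF P] I(3)[OF P]])
    show ?thesis unfolding comp_def by (rule someI[of _ S]) (use S in blast)
  qed
  obtain Ps where Ps: "set Ps = {P. minimal_prime_over R {\<zero>} P}" "distinct Ps"
    using finite_distinct_list[OF TAF_finite_minimal_primes[OF TAF zeroideal]] by blast
  have nth: "minimal_prime_over R {\<zero>} (Ps ! i)" if "i < length Ps" for i
    using nth_mem[OF that] Ps(1) by simp
  have "R \<simeq> RDirProd_list (map comp Ps)"
  \<comment> \<open>No minimal primes means that R is the zero ring, which is the empty product. It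
    is treated apart because \<open>chinese_remainder\<close> indexes the ideals by i \<le> n and so
    has at least one of them.\<close>
  proof (cases "Ps = []")
    case True
    then have "carrier R = {\<zero>}" using I(5) Ps(1) by auto
    then have "(\<lambda>_. []) \<in> ring_iso R (RDirProd_list [])"
      unfolding ring_iso_def ring_hom_def bij_betw_def inj_on_def by (auto simp: monoid.defs)
    then show ?thesis unfolding is_ring_iso_def using True by auto
  next
    case False
    then obtain n where n: "length Ps = Suc n" by (cases Ps) auto
    let ?I = "\<lambda>i. I (Ps ! i)"
    have zero: "(\<Inter>i\<le>n. ?I i) = {\<zero>}"
    proof
      show "(\<Inter>i\<le>n. ?I i) \<subseteq> {\<zero>}"
      proof
        fix u assume u: "u \<in> (\<Inter>i\<le>n. ?I i)"
        have "u \<in> carrier R" using u ideal_carr[OF I(1)[OF nth[of 0]]] n by auto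
        moreover have "u \<in> I P" if "minimal_prime_over R {\<zero>} P" for P
        proof -
          have "P \<in> set Ps" using that Ps(1) by simp
          then obtain i where "i < length Ps" "P = Ps ! i" by (auto simp: in_set_conv_nth)
          then show ?thesis using u n by auto
        qed
        ultimately show "u \<in> {\<zero>}" using I(5) by simp
      qed
      show "{\<zero>} \<subseteq> (\<Inter>i\<le>n. ?I i)" using ideal_zero[OF I(1)[OF nth]] n by simp
    qed
    have crt: "R Quot (\<Inter>i\<le>n. ?I i) \<simeq> RDirProd_list (map (\<lambda>i. R Quot (?I i)) [0..<Suc n])"
    proof (rule chinese_remainder)
      show "ideal (?I i) R" if "i \<le> n" for i using I(1)[OF nth] that n by simp
      show "?I i <+> ?I j = carrier R" if "i \<le> n" "j \<le> n" "i \<noteq> j" for i j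
        using that n Ps(2) by (intro I(4) nth) (auto simp: nth_eq_iff_index_eq)
    qed
    have "RDirProd_list (map (\<lambda>i. R Quot (?I i)) [0..<Suc n]) \<simeq> RDirProd_list (map comp Ps)"
    proof (rule RDirProd_list_iso_cong)
      show "list_all2 (\<simeq>) (map (\<lambda>i. R Quot (?I i)) [0..<Suc n]) (map comp Ps)"
        unfolding list_all2_conv_all_nth using comp[OF nth] n by (simp del: upt_Suc)
    qed
    from ring_iso_trans[OF ring_iso_trans[OF Quot_zero_iso crt[unfolded zero]] this]
    show ?thesis .
  qed
  moreover have "\<forall>S\<in>set (map comp Ps). ?good S" using comp Ps(1) by auto
  ultimately show ?thesis by blast
qed

text \<open>A chain of length one provides a nonmaximal prime P, which is minimal. Minimal primes
  have height zero, so uniqueness leaves P as the only one; its component is P itself, and the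
  intersection of all components is zero.\<close>

theorem TAF_domain_of_unique_height_zero:
  assumes TAF: "TAF_ring R" and dim: "krull_dim R = 1"
    and ex1: "\<exists>!P. primeideal P R \<and> prime_height R P = 0"
  shows "domain R"
proof -
  obtain P Q where PQ: "primeideal P R" "primeideal Q R" "P \<subset> Q" by (rule krull_dim_1_pair[OF dim])
  have P: "minimal_prime_over R {\<zero>} P" by (rule TAF_nonmaximal_prime_minimal[OF TAF PQ])
  have uniq: "N = P" if "minimal_prime_over R {\<zero>} N" for N
    using ex1 minimal_prime_height[OF that] minimal_prime_height[OF P] that P
    unfolding minimal_prime_over_def by blast
  have "\<not> maximalideal P R"
    using maximalideal.I_maximal[OF _ prime_ideal[OF PQ(2)]] PQ(3) primeideal.I_notcarr[OF PQ(2)]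
      ideal_carr[OF prime_ideal[OF PQ(2)]] by blast
  obtain I where C: "\<forall>P. minimal_prime_over R {\<zero>} P \<longrightarrow> ideal (I P) R"
    "\<forall>P. minimal_prime_over R {\<zero>} P \<longrightarrow> \<not> maximalideal P R \<longrightarrow> I P = P"
    "\<forall>P. minimal_prime_over R {\<zero>} P \<longrightarrow> maximalideal P R \<longrightarrow> (\<exists>n>0. I P = ideal_power P n)"
    "\<forall>P Q. minimal_prime_over R {\<zero>} P \<longrightarrow> minimal_prime_over R {\<zero>} Q \<longrightarrow> P \<noteq> Q \<longrightarrow>
      I P <+> I Q = carrier R"
    "\<forall>u\<in>carrier R. (\<forall>P. minimal_prime_over R {\<zero>} P \<longrightarrow> u \<in> I P) \<longrightarrow> u = \<zero>"
    by (rule TAF_components[OF TAF])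
  note I = C[rule_format]
  have "u = \<zero>" if "u \<in> P" for u
  proof (rule I(5)[OF ideal_carr[OF prime_ideal[OF PQ(1)] that]])
    fix N assume "minimal_prime_over R {\<zero>} N"
    then have "N = P" by (rule uniq)
    then show "u \<in> I N" using I(2)[OF P \<open>\<not> maximalideal P R\<close>] that by simp
  qed
  then have "P = {\<zero>}" using ideal_zero[OF prime_ideal[OF PQ(1)]] by blast
  then show ?thesis using zeroprimeideal_domainI PQ(1) by simp
qed

end

theorem theorem3p3:
  fixes R :: "('a, 'b) ring_scheme"
  assumes "TAF_ring R"
  shows "(\<exists>Rs :: 'a ring list.
            R \<simeq> RDirProd_list Rs \<and>
            (\<forall>S\<in>set Rs.
               (domain S \<and> krull_dim S = 1) \<or>
               (local_ring S \<and> krull_dim S = 0 \<and>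
                 (\<forall>M. maximalideal M S \<longrightarrow> nilpotent_ideal S M))))
       \<and> (krull_dim R = 1 \<and> (\<exists>!P. primeideal P R \<and> prime_height R P = 0) \<longrightarrow> domain R)"
proof -
  interpret cring R using assms unfolding TAF_ring_def by blast
  show ?thesis
    using TAF_direct_product[OF assms] TAF_domain_of_unique_height_zero[OF assms] by blast
qed

end
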